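(* Let $A$ be a finite set and let $X \subset A^{\mathbb{Z}}$ be a subshift of finite type. Then the following conditions are equivalent: (a) $X$ is injunctive; (b) every irreducible component of $X$ is finite and extremal (in the poset of irreducible components of $X$); (c) $X$ is countable with Cantor-Bendixson rank at most $2$.
   Context: $A^{\mathbb{Z}}$ carries the product topology ($A$ discrete) and the shift homeomorphism $\sigma$, $(\sigma(x))_i = x_{i+1}$. A subshift is a closed subset $X\subset A^{\mathbb{Z}}$ with $\sigma(X)=X$. It is of finite type if there are an integer $n\ge 0$ and $S\subset A^n$ such that $X$ is the set of all $x\in A^{\mathbb{Z}}$ with $(x_{i+1},\dots,x_{i+n})\in S$ for all $i\in\mathbb{Z}$. An endomorphism of $X$ is a continuous map $\tau\colon X\to X$ commuting with $\sigma$. $X$ is injunctive if every surjective endomorphism of $X$ is injective. A point $x\in X$ is non-wandering if for every neighborhood $U$ of $x$ in $X$ there is $n\ge 1$ with $U\cap\sigma^n(U)\ne\varnothing$; $\mathrm{NW}(X)$ is the set of non-wandering points of $X$. A subshift $Y$ is irreducible if it is non-empty and for all non-empty open $U,W\subset Y$ there is $n\ge 1$ with $U\cap\sigma^n(W)\ne\varnothing$. For a subshift of finite type $X$, there is a unique finite partition $\mathcal{C}$ of $\mathrm{NW}(X)$ into irreducible subshifts; its elements are the irreducible components of $X$. For $x\in X$, $\alpha(x)$ (resp. $\omega(x)$) is the set of limits of convergent sequences $(\sigma^{-n_k}(x))_k$ (resp. $(\sigma^{n_k}(x))_k$) with $(n_k)$ a strictly increasing sequence of non-negative integers; there are unique $C_\alpha(x),C_\omega(x)\in\mathcal{C}$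 with $\alpha(x)\subset C_\alpha(x)$, $\omega(x)\subset C_\omega(x)$. $\mathcal{C}$ is partially ordered by: $C\preceq C'$ iff there is $x\in X$ with $C_\alpha(x)=C$ and $C_\omega(x)=C'$. An element of a poset is extremal if it is minimal or maximal. For a topological space $X$: $Y'$ denotes the set of limit points of $Y$; $X^{(0)}=X$, $X^{(\alpha+1)}=(X^{(\alpha)})'$, $X^{(\lambda)}=\bigcap_{\alpha<\lambda}X^{(\alpha)}$ for limit ordinals $\lambda$. The Cantor-Bendixson rank of $X$ is the least ordinal $\alpha_0$ such that $X^{(\alpha)}=X^{(\alpha_0)}$ for all $\alpha\ge\alpha_0$. Countable means finite or countably infinite. *)

theory Defs
  imports "HOL-Analysis.Analysis" "HOL-Library.Disjoint_Sets"
begin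

section \<open>Shifts, subshifts and their endomorphisms\<close>

definition shift_topology :: "'a set \<Rightarrow> (int \<Rightarrow> 'a) topology" where
  "shift_topology A = product_topology (\<lambda>_. discrete_topology A) UNIV"

definition shift :: "(int \<Rightarrow> 'a) \<Rightarrow> int \<Rightarrow> 'a" where
  "shift x = (\<lambda>i. x (i + 1))"

definition subshift :: "'a set \<Rightarrow> (int \<Rightarrow> 'a) set \<Rightarrow> bool" where
  "subshift A X \<longleftrightarrow> closedin (shift_topology A) X \<and> shift ` X = X"

text \<open>The word \<open>(x (i + 1), \<dots>, x (i + n))\<close>; the set \<open>A\<^sup>n\<close> is rendered as the set of
  lists of length \<open>n\<close> over \<open>A\<close>.\<close>

definition window :: "nat \<Rightarrow> (int \<Rightarrow> 'a) \<Rightarrow> int \<Rightarrow> 'a list" where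
  "window n x i = map (\<lambda>k. x (i + int k)) [1..<n + 1]"

definition subshift_of_finite_type :: "'a set \<Rightarrow> (int \<Rightarrow> 'a) set \<Rightarrow> bool" where
  "subshift_of_finite_type A X \<longleftrightarrow> subshift A X \<and>
     (\<exists>n S. S \<subseteq> {w. length w = n \<and> set w \<subseteq> A} \<and>
        X = {x. (\<forall>i. x i \<in> A) \<and> (\<forall>i. window n x i \<in> S)})"

definition endomorphism :: "'a set \<Rightarrow> (int \<Rightarrow> 'a) set \<Rightarrow> ((int \<Rightarrow> 'a) \<Rightarrow> int \<Rightarrow> 'a) \<Rightarrow> bool" where
  "endomorphism A X \<tau> \<longleftrightarrow>
     continuous_map (subtopology (shift_topology A) X) (subtopology (shift_topology A) X) \<tau> \<and>
     (\<forall>x\<in>X. \<tau> (shift x) = shift (\<tau> x))"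

definition injunctive :: "'a set \<Rightarrow> (int \<Rightarrow> 'a) set \<Rightarrow> bool" where
  "injunctive A X \<longleftrightarrow> (\<forall>\<tau>. endomorphism A X \<tau> \<and> \<tau> ` X = X \<longrightarrow> inj_on \<tau> X)"


section \<open>Irreducible components and their order\<close>

definition neighborhood_in :: "'b topology \<Rightarrow> 'b \<Rightarrow> 'b set \<Rightarrow> bool" where
  "neighborhood_in T x U \<longleftrightarrow> U \<subseteq> topspace T \<and> (\<exists>V. openin T V \<and> x \<in> V \<and> V \<subseteq> U)"

definition NW :: "'a set \<Rightarrow> (int \<Rightarrow> 'a) set \<Rightarrow> (int \<Rightarrow> 'a) set" where
  "NW A X = {x \<in> X. \<forall>U. neighborhood_in (subtopology (shift_topology A) X) x U \<longrightarrow>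
                         (\<exists>n\<ge>1. U \<inter> (shift ^^ n) ` U \<noteq> {})}"

definition irreducible_subshift :: "'a set \<Rightarrow> (int \<Rightarrow> 'a) set \<Rightarrow> bool" where
  "irreducible_subshift A Y \<longleftrightarrow> subshift A Y \<and> Y \<noteq> {} \<and>
     (\<forall>U W. openin (subtopology (shift_topology A) Y) U \<and> U \<noteq> {} \<and>
            openin (subtopology (shift_topology A) Y) W \<and> W \<noteq> {} \<longrightarrow>
            (\<exists>n\<ge>1. U \<inter> (shift ^^ n) ` W \<noteq> {}))"

definition irreducible_components :: "'a set \<Rightarrow> (int \<Rightarrow> 'a) set \<Rightarrow> (int \<Rightarrow> 'a) set set" where
  "irreducible_components A X =
     (THE \<C>. finite \<C> \<and> partition_on (NW A X) \<C> \<and> (\<forall>C\<in>\<C>. irreducible_subshift A C))"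

definition alpha_limit :: "'a set \<Rightarrow> (int \<Rightarrow> 'a) \<Rightarrow> (int \<Rightarrow> 'a) set" where
  "alpha_limit A x = {y. \<exists>n :: nat \<Rightarrow> nat. strict_mono n \<and>
     limitin (shift_topology A) (\<lambda>k. (inv shift ^^ n k) x) y sequentially}"

definition omega_limit :: "'a set \<Rightarrow> (int \<Rightarrow> 'a) \<Rightarrow> (int \<Rightarrow> 'a) set" where
  "omega_limit A x = {y. \<exists>n :: nat \<Rightarrow> nat. strict_mono n \<and>
     limitin (shift_topology A) (\<lambda>k. (shift ^^ n k) x) y sequentially}"

definition C_alpha :: "'a set \<Rightarrow> (int \<Rightarrow> 'a) set \<Rightarrow> (int \<Rightarrow> 'a) \<Rightarrow> (int \<Rightarrow> 'a) set" where
  "C_alpha A X x = (THE C. C \<in> irreducible_components A X \<and> alpha_limit A x \<subseteq> C)"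

definition C_omega :: "'a set \<Rightarrow> (int \<Rightarrow> 'a) set \<Rightarrow> (int \<Rightarrow> 'a) \<Rightarrow> (int \<Rightarrow> 'a) set" where
  "C_omega A X x = (THE C. C \<in> irreducible_components A X \<and> omega_limit A x \<subseteq> C)"

definition component_le ::
  "'a set \<Rightarrow> (int \<Rightarrow> 'a) set \<Rightarrow> (int \<Rightarrow> 'a) set \<Rightarrow> (int \<Rightarrow> 'a) set \<Rightarrow> bool" where
  "component_le A X C C' \<longleftrightarrow> (\<exists>x\<in>X. C_alpha A X x = C \<and> C_omega A X x = C')"

definition extremal_in :: "'b set \<Rightarrow> ('b \<Rightarrow> 'b \<Rightarrow> bool) \<Rightarrow> 'b \<Rightarrow> bool" where
  "extremal_in P le c \<longleftrightarrow> c \<in> P \<and>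
     ((\<forall>d\<in>P. le d c \<longrightarrow> d = c) \<or> (\<forall>d\<in>P. le c d \<longrightarrow> d = c))"


section \<open>Ordinals and Cantor-Bendixson rank\<close>

text \<open>The ordinals below the successor of the cardinal \<open>\<aleph>\<^sub>0 + |'b|\<close>. The summand \<open>nat\<close> makes all
  finite ordinals available for every \<open>'b\<close>. The derivatives of a \<open>T\<^sub>1\<close> space whose points have type \<open>'b\<close>
  stabilise at one of these ordinals (lemma \<open>cb_derivative_stabilises\<close> below), so no larger
  ordinals are needed to define the rank.\<close>

lemma infinite_Field_cardSuc: "infinite (Field (cardSuc (card_of (UNIV :: (nat + 'b) set))))"
  by (simp add: card_of_cardSuc_finite finite_Plus_UNIV_iff)

typedef 'b ordinal = "Field (cardSuc (card_of (UNIV :: (nat + 'b) set)))"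
  using infinite_Field_cardSuc[where 'b = 'b] by (metis ex_in_conv finite.emptyI)

instantiation ordinal :: (type) linorder
begin

definition less_eq_ordinal :: "'a ordinal \<Rightarrow> 'a ordinal \<Rightarrow> bool" where
  "\<alpha> \<le> \<beta> \<longleftrightarrow> (Rep_ordinal \<alpha>, Rep_ordinal \<beta>) \<in> cardSuc (card_of (UNIV :: (nat + 'a) set))"

definition less_ordinal :: "'a ordinal \<Rightarrow> 'a ordinal \<Rightarrow> bool" where
  "\<alpha> < \<beta> \<longleftrightarrow> \<alpha> \<le> \<beta> \<and> \<not> \<beta> \<le> \<alpha>" for \<alpha> \<beta> :: "'a ordinal"

lemma Well_order_cardSuc_UNIV: "Well_order (cardSuc (card_of (UNIV :: 'c set)))"
  using cardSuc_Card_order[OF card_of_Card_order] card_order_on_well_order_on by blast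

instance
proof
  fix x y z :: "'a ordinal"
  let ?r = "cardSuc (card_of (UNIV :: (nat + 'a) set))"
  have lin: "refl_on (Field ?r) ?r" "trans ?r" "antisym ?r" "total_on (Field ?r) ?r"
    using Well_order_cardSuc_UNIV[where 'c = "nat + 'a"]
    by (auto simp: well_order_on_def linear_order_on_def partial_order_on_def preorder_on_def)
  show "(x < y) = (x \<le> y \<and> \<not> y \<le> x)" by (rule less_ordinal_def)
  show "x \<le> x"
    using lin(1) Rep_ordinal[of x] by (auto simp: less_eq_ordinal_def refl_on_def)
  show "x \<le> y \<Longrightarrow> y \<le> z \<Longrightarrow> x \<le> z"
    using lin(2) unfolding less_eq_ordinal_def by (meson transD)
  show "x \<le> y \<Longrightarrow> y \<le> x \<Longrightarrow> x = y"
    using lin(3) unfolding less_eq_ordinal_def by (meson antisymD Rep_ordinal_inject)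
  show "x \<le> y \<or> y \<le> x"
    using lin(4) \<open>x \<le> x\<close> Rep_ordinal[of x] Rep_ordinal[of y]
    by (cases "x = y") (auto simp: less_eq_ordinal_def total_on_def Rep_ordinal_inject)
qed

end

instance ordinal :: (type) wellorder
proof (rule wf_wellorderI)
  let ?r = "cardSuc (card_of (UNIV :: (nat + 'a) set))"
  have "wf (?r - Id)"
    using Well_order_cardSuc_UNIV by (auto simp: well_order_on_def)
  then have "wf (inv_image (?r - Id) (Rep_ordinal :: 'a ordinal \<Rightarrow> _))"
    by (rule wf_inv_image)
  moreover have "{(x, y). x < y} \<subseteq> inv_image (?r - Id) (Rep_ordinal :: 'a ordinal \<Rightarrow> _)"
    by (auto simp: inv_image_def less_ordinal_def less_eq_ordinal_def)
  ultimately show "wf {(x :: 'a ordinal, y). x < y}"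
    by (rule wf_subset)
qed standard

instance ordinal :: (type) no_top
proof
  fix \<alpha> :: "'a ordinal"
  let ?r = "cardSuc (card_of (UNIV :: (nat + 'a) set))"
  obtain b where b: "b \<in> Field ?r" "Rep_ordinal \<alpha> \<noteq> b" "(Rep_ordinal \<alpha>, b) \<in> ?r"
    using infinite_Card_order_limit[OF cardSuc_Card_order[OF card_of_Card_order]
        infinite_Field_cardSuc Rep_ordinal[of \<alpha>]] by blast
  then have "\<alpha> \<le> Abs_ordinal b" "\<alpha> \<noteq> Abs_ordinal b"
    by (auto simp: less_eq_ordinal_def Abs_ordinal_inverse)
  then show "\<exists>\<beta>. \<alpha> < \<beta>" by (metis order_le_less)
qed

instantiation ordinal :: (type) zero
begin

definition zero_ordinal :: "'a ordinal" where
  "0 = (LEAST \<alpha> :: 'a ordinal. True)"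

instance ..

end

definition osucc :: "'b ordinal \<Rightarrow> 'b ordinal" where
  "osucc \<alpha> = (LEAST \<beta>. \<alpha> < \<beta>)"

lemma zero_le_ordinal [simp]: "0 \<le> (\<alpha> :: 'b ordinal)"
  unfolding zero_ordinal_def by (rule Least_le) simp

lemma less_osucc [simp]: "\<alpha> < osucc \<alpha>"
  unfolding osucc_def by (rule LeastI_ex) (rule gt_ex)

lemma osucc_le_iff: "osucc \<alpha> \<le> \<beta> \<longleftrightarrow> \<alpha> < \<beta>"
proof
  show "osucc \<alpha> \<le> \<beta> \<Longrightarrow> \<alpha> < \<beta>" using less_osucc order_less_le_trans by blast
  show "\<alpha> < \<beta> \<Longrightarrow> osucc \<alpha> \<le> \<beta>" unfolding osucc_def by (rule Least_le)
qed

lemma osucc_inject [simp]: "osucc \<alpha> = osucc \<beta> \<longleftrightarrow> \<alpha> = \<beta>"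
  by (metis (full_types) less_irrefl less_osucc linorder_neqE osucc_le_iff order_less_le_trans)

lemma osucc_neq_zero [simp]: "osucc \<alpha> \<noteq> 0"
  using less_osucc[of \<alpha>] zero_le_ordinal[of \<alpha>] by (metis not_less)

lemma less_osucc_iff: "\<beta> < osucc \<alpha> \<longleftrightarrow> \<beta> \<le> \<alpha>"
  by (meson not_less osucc_le_iff)

text \<open>The three cases are zero, successor and limit ordinals; see the lemmas
  \<open>cb_derivative_0\<close>, \<open>cb_derivative_osucc\<close>, \<open>cb_derivative_limit\<close>.\<close>

function cb_derivative :: "'b topology \<Rightarrow> 'b ordinal \<Rightarrow> 'b set" where
  "cb_derivative T \<alpha> =
     (if \<alpha> = 0 then topspace T
      else if \<exists>\<beta>. \<alpha> = osucc \<beta> then T derived_set_of cb_derivative T (THE \<beta>. \<alpha> = osucc \<beta>)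
      else (\<Inter>\<beta>\<in>{..<\<alpha>}. cb_derivative T \<beta>))"
  by auto
termination
  by (relation "inv_image {(\<alpha>, \<beta>). \<alpha> < \<beta>} snd") (auto intro: wf)

declare cb_derivative.simps [simp del]

lemma cb_derivative_0: "cb_derivative T 0 = topspace T"
  by (simp add: cb_derivative.simps)

lemma cb_derivative_osucc: "cb_derivative T (osucc \<alpha>) = T derived_set_of cb_derivative T \<alpha>"
  by (subst cb_derivative.simps) simp

lemma cb_derivative_limit:
  assumes "\<alpha> \<noteq> 0" and "\<nexists>\<beta>. \<alpha> = osucc \<beta>"
  shows "cb_derivative T \<alpha> = (\<Inter>\<beta>\<in>{..<\<alpha>}. cb_derivative T \<beta>)"
  using assms by (subst cb_derivative.simps) simp

lemma closedin_cb_derivative_antimono: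
  "closedin T (cb_derivative T \<alpha>) \<and> (\<forall>\<beta>\<le>\<alpha>. cb_derivative T \<alpha> \<subseteq> cb_derivative T \<beta>)"
  if "t1_space T"
  for T :: "'b topology"
proof (induction \<alpha> rule: less_induct)
  case (less \<alpha>)
  consider "\<alpha> = 0" | \<beta> where "\<alpha> = osucc \<beta>" | "\<alpha> \<noteq> 0" "\<nexists>\<beta>. \<alpha> = osucc \<beta>"
    by blast
  then show ?case
  proof cases
    case 1
    then show ?thesis by (metis cb_derivative_0 closedin_topspace antisym zero_le_ordinal order_refl)
  next
    case 2
    have *: "closedin T (cb_derivative T \<beta>)"
      "\<forall>\<gamma>\<le>\<beta>. cb_derivative T \<beta> \<subseteq> cb_derivative T \<gamma>"
      using less.IH[of \<beta>] 2 by auto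
    have sub: "cb_derivative T \<alpha> \<subseteq> cb_derivative T \<beta>"
      using *(1) by (simp add: 2 cb_derivative_osucc closedin_contains_derived_set)
    have "\<gamma> = \<alpha> \<or> \<gamma> \<le> \<beta>" if "\<gamma> \<le> \<alpha>" for \<gamma>
      using that 2 less_osucc_iff order_le_less by blast
    moreover have "closedin T (cb_derivative T \<alpha>)"
      using that by (simp add: 2 cb_derivative_osucc closedin_derived_set_of_gen *(1) closedin_subset)
    ultimately show ?thesis using sub *(2) by blast
  next
    case 3
    then have eq: "cb_derivative T \<alpha> = (\<Inter>\<beta>\<in>{..<\<alpha>}. cb_derivative T \<beta>)"
      by (rule cb_derivative_limit)
    have "0 < \<alpha>" using 3 by (metis order_le_less zero_le_ordinal)
    then have "closedin T (cb_derivative T \<alpha>)"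
      unfolding eq using less.IH by (intro closedin_Inter) auto
    moreover have "cb_derivative T \<alpha> \<subseteq> cb_derivative T \<beta>" if "\<beta> \<le> \<alpha>" for \<beta>
      using that by (cases "\<beta> = \<alpha>") (auto simp: eq order_le_less)
    ultimately show ?thesis by blast
  qed
qed

lemma cb_derivative_constant:
  fixes T :: "'b topology"
  assumes "t1_space T" and eq: "cb_derivative T (osucc \<alpha>) = cb_derivative T \<alpha>" and "\<alpha> \<le> \<beta>"
  shows "cb_derivative T \<beta> = cb_derivative T \<alpha>"
  using \<open>\<alpha> \<le> \<beta>\<close>
proof (induction \<beta> rule: less_induct)
  case (less \<beta>)
  show ?case
  proof (cases "\<beta> = \<alpha>")
    case False
    then have lt: "\<alpha> < \<beta>" using less.prems by simp
    consider \<gamma> where "\<beta> = osucc \<gamma>" | "\<nexists>\<gamma>. \<beta> = osucc \<gamma>" by blast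
    then show ?thesis
    proof cases
      case 1
      then have "\<alpha> \<le> \<gamma>" using lt by (simp add: less_osucc_iff)
      then have "cb_derivative T \<gamma> = cb_derivative T \<alpha>" using less.IH[of \<gamma>] 1 by simp
      then show ?thesis using eq by (simp add: 1 cb_derivative_osucc)
    next
      case 2
      have "\<beta> \<noteq> 0" using lt by (metis leD zero_le_ordinal)
      then have lim: "cb_derivative T \<beta> = (\<Inter>\<gamma>\<in>{..<\<beta>}. cb_derivative T \<gamma>)"
        using 2 by (rule cb_derivative_limit)
      have "cb_derivative T \<alpha> \<subseteq> cb_derivative T \<gamma>" if "\<gamma> < \<beta>" for \<gamma>
      proof (cases "\<alpha> \<le> \<gamma>")
        case True
        then show ?thesis using less.IH[OF that] by simp
      next
        case False
        then have "\<gamma> \<le> \<alpha>" by simp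
        then show ?thesis
          using closedin_cb_derivative_antimono[OF \<open>t1_space T\<close>, of \<alpha>] by blast
      qed
      then have "cb_derivative T \<alpha> \<subseteq> cb_derivative T \<beta>"
        unfolding lim by (intro INT_greatest) simp
      moreover have "cb_derivative T \<beta> \<subseteq> cb_derivative T \<alpha>"
        using lt unfolding lim by (intro INT_lower) simp
      ultimately show ?thesis by (rule subset_antisym[rotated])
    qed
  qed simp
qed

lemma cb_derivative_stabilises:
  fixes T :: "'b topology"
  assumes "t1_space T"
  shows "\<exists>\<alpha>\<^sub>0. \<forall>\<alpha>\<ge>\<alpha>\<^sub>0. cb_derivative T \<alpha> = cb_derivative T \<alpha>\<^sub>0"
proof (rule ccontr)
  let ?U = "card_of (UNIV :: (nat + 'b) set)"
  assume "\<not> ?thesis"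
  then have ne: "cb_derivative T (osucc \<alpha>) \<noteq> cb_derivative T \<alpha>" for \<alpha>
    using cb_derivative_constant[OF assms] by metis
  note mono = closedin_cb_derivative_antimono[OF assms, THEN conjunct2, rule_format]
  have "\<exists>x. x \<in> cb_derivative T \<alpha> - cb_derivative T (osucc \<alpha>)" for \<alpha>
    using ne[of \<alpha>] mono[OF less_imp_le[OF less_osucc[of \<alpha>]]] by auto
  then obtain f where f: "f \<alpha> \<in> cb_derivative T \<alpha> - cb_derivative T (osucc \<alpha>)" for \<alpha>
    by metis
  have "f \<alpha> \<noteq> f \<gamma>" if "\<alpha> < \<gamma>" for \<alpha> \<gamma>
    using f[of \<alpha>] f[of \<gamma>] mono[of "osucc \<alpha>" \<gamma>] that by (auto simp: osucc_le_iff)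
  then have "inj f" by (metis injI linorder_neqE)
  have "inj_on (\<lambda>a. Inr (f (Abs_ordinal a)) :: nat + 'b) (Field (cardSuc ?U))"
    using \<open>inj f\<close> by (intro inj_onI) (metis Abs_ordinal_inject Inr_inject injD)
  then have "(card_of (Field (cardSuc ?U)), ?U) \<in> ordLeq"
    using card_of_ordLeq by blast
  moreover have "(card_of (Field (cardSuc ?U)), cardSuc ?U) \<in> ordIso"
    by (intro card_of_Field_ordIso cardSuc_Card_order card_of_Card_order)
  ultimately have "(cardSuc ?U, ?U) \<in> ordLeq"
    by (meson ordIso_symmetric ordIso_ordLeq_trans)
  then show False
    using cardSuc_greater[OF card_of_Card_order] not_ordLess_ordLeq by blast
qed

definition cb_rank :: "'b topology \<Rightarrow> 'b ordinal" where
  "cb_rank T = (LEAST \<alpha>\<^sub>0. \<forall>\<alpha>\<ge>\<alpha>\<^sub>0. cb_derivative T \<alpha> = cb_derivative T \<alpha>\<^sub>0)"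

end

theory Submission
  imports Defs
begin

text \<open>
  A subshift of finite type is determined by its windows of some fixed length \<open>n\<close>, and points
  of \<open>X\<close> can be spliced wherever their windows coincide. ``The window \<open>w\<close> can occur after the
  window \<open>v\<close> in a point of \<open>X\<close>'' is a preorder on the recurrent windows, and its classes are the
  irreducible components. Some component is infinite iff two distinct periodic points share a
  window (\<open>ambiguous\<close>), and all components are extremal iff every recurrent window is minimal or
  maximal in the preorder (\<open>two_layered\<close>). So condition (b) says \<open>\<not> ambiguous \<and> two_layered\<close>.

  If (b) holds, then \<open>X\<close> consists of finitely many shift orbits, its nonperiodic points are isolated,
  and a surjective endomorphism permutes the orbits; this gives (a) and (c).

  If \<open>X\<close> is ambiguous, then blocks of two periodic points can be concatenated freely, so \<open>X\<close> is
  uncountable. Moreover a nonoverlapping marker with one free bit can be built from these blocks, and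
  adding to each bit the bit of the adjacent marker to the right, if there is one, is a surjective
  endomorphism that is not injective.

  If \<open>X\<close> is not ambiguous but some periodic orbit lies strictly between two others, then sliding the
  exit from this middle orbit to a maximal one by a common period to the left is surjective and not
  injective. Also, the middle orbit lies in the second derivative of \<open>X\<close>; with rank at most 2 this
  derivative is a nonempty perfect compact set, which is uncountable by Baire's theorem.
\<close>

section \<open>Translations, splicing, periodicity and central windows\<close>

definition translate :: "int \<Rightarrow> (int \<Rightarrow> 'a) \<Rightarrow> int \<Rightarrow> 'a" where
  "translate k x = (\<lambda>i. x (i + k))"

definition splice_at :: "int \<Rightarrow> (int \<Rightarrow> 'a) \<Rightarrow> (int \<Rightarrow> 'a) \<Rightarrow> int \<Rightarrow> 'a" where
  "splice_at i x y = (\<lambda>k. if k < i then x k else y k)"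

definition periodic :: "int \<Rightarrow> (int \<Rightarrow> 'a) \<Rightarrow> bool" where
  "periodic T x \<longleftrightarrow> (\<forall>i. x (i + T) = x i)"

text \<open>The sets of points that agree with \<open>x\<close> on \<open>[-m, m]\<close> form a
  neighborhood basis at \<open>x\<close>; most of the topology below is reduced to this
  relation.\<close>

definition agree :: "nat \<Rightarrow> (int \<Rightarrow> 'a) \<Rightarrow> (int \<Rightarrow> 'a) \<Rightarrow> bool" where
  "agree m x y \<longleftrightarrow> (\<forall>k. \<bar>k\<bar> \<le> int m \<longrightarrow> x k = y k)"

lemma translate_apply [simp]: "translate k x i = x (i + k)"
  by (simp add: translate_def)

lemma translate_translate [simp]: "translate k (translate l x) = translate (k + l) x"
  by (simp add: translate_def algebra_simps)

lemma translate_0 [simp]: "translate 0 x = x"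
  by (simp add: translate_def)

lemma shift_eq_translate: "shift = translate 1"
  by (simp add: shift_def translate_def fun_eq_iff)

lemma shift_funpow: "(shift ^^ m) x = translate (int m) x"
  by (induction m) (simp_all add: shift_eq_translate algebra_simps)

lemma inv_shift: "inv shift = translate (- 1)"
  by (rule inv_equality) (simp_all add: shift_eq_translate)

lemma inv_shift_funpow: "(inv shift ^^ m) x = translate (- int m) x"
  by (induction m) (simp_all add: inv_shift algebra_simps)

lemma periodic_mult_nat: "periodic T x \<Longrightarrow> x (i + T * int m) = x i"
proof (induction m)
  case (Suc m)
  then have "x (i + T * int m + T) = x i" by (simp add: periodic_def)
  then show ?case by (simp add: algebra_simps)
qed simp

lemma periodic_mult:
  assumes "periodic T x"
  shows "x (i + T * m) = x i"
proof (cases "m \<ge> 0")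
  case True
  then show ?thesis using periodic_mult_nat[OF assms, of i "nat m"] by simp
next
  case False
  then show ?thesis using periodic_mult_nat[OF assms, of "i + T * m" "nat (- m)"]
    by (simp add: algebra_simps)
qed

lemma periodic_times: "periodic T x \<Longrightarrow> periodic (T * m) x"
  unfolding periodic_def[of "T * m"] using periodic_mult by blast

lemma periodic_mod:
  assumes "periodic T x"
  shows "x (i mod T) = x i"
  using periodic_mult[OF assms, of "i mod T" "i div T"] by (simp add: mult.commute)

lemma periodic_translate: "periodic T x \<Longrightarrow> periodic T (translate k x)"
  unfolding periodic_def translate_apply by (simp add: add.assoc add.commute[of T k]) (simp flip: add.assoc)

lemma periodic_common:
  assumes "periodic S x" "periodic T y" "0 < S" "0 < T"
  shows "\<exists>U>0. periodic U x \<and> periodic U y"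
  using periodic_times[OF assms(1), of T] periodic_times[OF assms(2), of S] assms(3,4)
  by (intro exI[of _ "S * T"]) (simp add: mult.commute)

lemma agree_refl [simp]: "agree m x x"
  by (simp add: agree_def)

subsection \<open>The topology of the full shift\<close>

lemma topspace_shift_topology: "topspace (shift_topology A) = {x. \<forall>i. x i \<in> A}"
  by (auto simp: shift_topology_def)

text \<open>A basic open set of the product restricts only finitely many coordinates, and these lie
  in some \<open>[-m, m]\<close>. Conversely, prescribing the letters on \<open>[-m, m]\<close>
  gives a product of singletons and copies of \<open>A\<close>.\<close>

lemma openin_shift_topology_iff:
  "openin (shift_topology A) U \<longleftrightarrow>
     U \<subseteq> {x. \<forall>i. x i \<in> A} \<and> (\<forall>x\<in>U. \<exists>m. \<forall>y. (\<forall>i. y i \<in> A) \<and> agree m x y \<longrightarrow> y \<in> U)"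
  (is "?l \<longleftrightarrow> ?r")
proof
  assume l: ?l
  have "\<exists>m. \<forall>y. (\<forall>i. y i \<in> A) \<and> agree m x y \<longrightarrow> y \<in> U" if x: "x \<in> U" for x
  proof -
    obtain V where V': "finite {i \<in> UNIV. V i \<noteq> topspace (discrete_topology A)}"
      "\<forall>i\<in>UNIV. openin (discrete_topology A) (V i)" "x \<in> Pi\<^sub>E UNIV V" "Pi\<^sub>E UNIV V \<subseteq> U"
      using l x unfolding shift_topology_def openin_product_topology_alt by meson
    have fin: "finite {i. V i \<noteq> A}" and V: "\<And>i. V i \<subseteq> A" "\<And>i. x i \<in> V i" "Pi\<^sub>E UNIV V \<subseteq> U"
      using V' by (auto simp: PiE_iff)
    obtain m where m: "\<forall>i\<in>{i. V i \<noteq> A}. nat \<bar>i\<bar> \<le> m"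
      using finite_nat_set_iff_bounded_le[of "(\<lambda>i. nat \<bar>i\<bar>) ` {i. V i \<noteq> A}"] fin by auto
    have "y \<in> U" if "\<forall>i. y i \<in> A" "agree m x y" for y
    proof -
      have "y i \<in> V i" for i
      proof (cases "V i = A")
        case False
        then have "nat \<bar>i\<bar> \<le> m" using m by blast
        then have "\<bar>i\<bar> \<le> int m" by linarith
        then show ?thesis using that(2) V(2)[of i] by (simp add: agree_def)
      qed (use that in simp)
      then show ?thesis using V(3) by auto
    qed
    then show ?thesis by blast
  qed
  then show ?r using openin_subset[OF l] by (simp add: topspace_shift_topology)
next
  assume r: ?r
  show ?l
    unfolding shift_topology_def openin_product_topology_alt
  proof
    fix x assume x: "x \<in> U"
    then obtain m where m: "\<forall>y. (\<forall>i. y i \<in> A) \<and> agree m x y \<longrightarrow> y \<in> U" using r by blast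
    define V where "V i = (if \<bar>i\<bar> \<le> int m then {x i} else A)" for i
    have xA: "x i \<in> A" for i using r x by blast
    have "{i. V i \<noteq> A} \<subseteq> {- int m..int m}" by (auto simp: V_def split: if_splits)
    then have "finite {i. V i \<noteq> A}" by (rule finite_subset) simp
    moreover have "Pi\<^sub>E UNIV V \<subseteq> U"
    proof
      fix y assume y: "y \<in> Pi\<^sub>E UNIV V"
      then have yV: "y i \<in> V i" for i by auto
      have "y i \<in> A" for i using yV[of i] xA[of i] by (auto simp: V_def split: if_splits)
      moreover have "agree m x y" using yV by (auto simp: V_def agree_def) (metis singletonD)
      ultimately show "y \<in> U" using m by blast
    qed
    moreover have "x \<in> Pi\<^sub>E UNIV V" "\<And>i. V i \<subseteq> A" using xA by (auto simp: V_def)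
    ultimately show "\<exists>V. finite {i \<in> UNIV. V i \<noteq> topspace (discrete_topology A)} \<and>
        (\<forall>i\<in>UNIV. openin (discrete_topology A) (V i)) \<and> x \<in> Pi\<^sub>E UNIV V \<and> Pi\<^sub>E UNIV V \<subseteq> U"
      by (intro exI[of _ V]) simp
  qed
qed

lemma openin_cylinder:
  "openin (shift_topology A) {y. (\<forall>i. y i \<in> A) \<and> agree m x y}"
  unfolding openin_shift_topology_iff
proof (intro conjI ballI exI[of _ m] allI impI)
  fix y z assume "y \<in> {y. (\<forall>i. y i \<in> A) \<and> agree m x y}" "(\<forall>i. z i \<in> A) \<and> agree m y z"
  then show "z \<in> {y. (\<forall>i. y i \<in> A) \<and> agree m x y}" by (simp add: agree_def)
qed blast

lemma openin_subtopology_shift_iff: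
  assumes Y: "Y \<subseteq> {x. \<forall>i. x i \<in> A}"
  shows "openin (subtopology (shift_topology A) Y) U \<longleftrightarrow>
     U \<subseteq> Y \<and> (\<forall>x\<in>U. \<exists>m. \<forall>y\<in>Y. agree m x y \<longrightarrow> y \<in> U)"
  (is "?l \<longleftrightarrow> ?r")
proof
  assume ?l
  then obtain V where V: "openin (shift_topology A) V" "U = V \<inter> Y"
    by (auto simp: openin_subtopology)
  show ?r
  proof (intro conjI ballI)
    fix x assume "x \<in> U"
    then obtain m where "\<forall>y. (\<forall>i. y i \<in> A) \<and> agree m x y \<longrightarrow> y \<in> V"
      using V unfolding openin_shift_topology_iff by blast
    then show "\<exists>m. \<forall>y\<in>Y. agree m x y \<longrightarrow> y \<in> U" using V(2) Y by blast
  qed (use V in auto)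
next
  assume r: ?r
  show ?l
    unfolding openin_subopen[of _ U]
  proof
    fix x assume x: "x \<in> U"
    then obtain m where m: "\<forall>y\<in>Y. agree m x y \<longrightarrow> y \<in> U" using r by blast
    let ?V = "{y. (\<forall>i. y i \<in> A) \<and> agree m x y} \<inter> Y"
    have "openin (subtopology (shift_topology A) Y) ?V"
      by (intro openin_subtopology_Int openin_cylinder)
    moreover have "x \<in> ?V" "?V \<subseteq> U" using x r Y m by auto
    ultimately show "\<exists>V. openin (subtopology (shift_topology A) Y) V \<and> x \<in> V \<and> V \<subseteq> U" by blast
  qed
qed

lemma topspace_subtopology_shift:
  "Y \<subseteq> {x. \<forall>i. x i \<in> A} \<Longrightarrow> topspace (subtopology (shift_topology A) Y) = Y"
  by (auto simp: topspace_shift_topology)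

lemma closedin_shift_topology_iff:
  "closedin (shift_topology A) S \<longleftrightarrow>
     S \<subseteq> {x. \<forall>i. x i \<in> A} \<and> (\<forall>x. (\<forall>i. x i \<in> A) \<and> (\<forall>m. \<exists>y\<in>S. agree m x y) \<longrightarrow> x \<in> S)"
proof (cases "S \<subseteq> {x. \<forall>i. x i \<in> A}")
  case True
  let ?D = "{x. \<forall>i. x i \<in> A} - S"
  have "closedin (shift_topology A) S \<longleftrightarrow>
      (\<forall>x\<in>?D. \<exists>m. \<forall>y. (\<forall>i. y i \<in> A) \<and> agree m x y \<longrightarrow> y \<in> ?D)"
    unfolding closedin_def openin_shift_topology_iff topspace_shift_topology using True by simp
  also have "\<dots> \<longleftrightarrow> (\<forall>x\<in>?D. \<exists>m. \<not> (\<exists>y\<in>S. agree m x y))"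
  proof -
    have "(\<forall>y. (\<forall>i. y i \<in> A) \<and> agree m x y \<longrightarrow> y \<in> ?D) \<longleftrightarrow> \<not> (\<exists>y\<in>S. agree m x y)" for m x
      using True by blast
    then show ?thesis by simp
  qed
  also have "\<dots> \<longleftrightarrow> (\<forall>x. (\<forall>i. x i \<in> A) \<and> (\<forall>m. \<exists>y\<in>S. agree m x y) \<longrightarrow> x \<in> S)"
    unfolding Ball_def Diff_iff mem_Collect_eq by meson
  finally show ?thesis using True by simp
qed (simp add: closedin_def topspace_shift_topology)

lemma Hausdorff_shift_topology: "Hausdorff_space (shift_topology A)"
  unfolding shift_topology_def by (simp add: Hausdorff_space_product_topology)

lemma compact_shift_topology: "finite A \<Longrightarrow> compact_space (shift_topology A)"
  unfolding shift_topology_def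
  by (simp add: compact_space_product_topology compact_space_discrete_topology)

lemma in_derived_set_of_shift_iff:
  assumes "Y \<subseteq> {x. \<forall>i. x i \<in> A}"
  shows "x \<in> subtopology (shift_topology A) Y derived_set_of S \<longleftrightarrow>
     x \<in> Y \<and> (\<forall>m. \<exists>y\<in>S \<inter> Y. y \<noteq> x \<and> agree m x y)"
  (is "?l \<longleftrightarrow> ?r")
proof
  assume l: ?l
  show ?r
  proof (intro conjI allI)
    fix m
    have "openin (subtopology (shift_topology A) Y) ({y. (\<forall>i. y i \<in> A) \<and> agree m x y} \<inter> Y)"
      by (intro openin_subtopology_Int openin_cylinder)
    moreover have "x \<in> {y. (\<forall>i. y i \<in> A) \<and> agree m x y} \<inter> Y"
      using l assms by (auto simp: in_derived_set_of)
    ultimately obtain y where "y \<noteq> x" "y \<in> S" "y \<in> {y. (\<forall>i. y i \<in> A) \<and> agree m x y} \<inter> Y"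
      using l unfolding in_derived_set_of by meson
    then show "\<exists>y\<in>S \<inter> Y. y \<noteq> x \<and> agree m x y" by blast
  qed (use l in \<open>auto simp: in_derived_set_of\<close>)
next
  assume r: ?r
  show ?l
    unfolding in_derived_set_of topspace_subtopology_shift[OF assms]
      openin_subtopology_shift_iff[OF assms]
  proof (intro conjI allI impI, use r in blast)
    fix T assume T: "x \<in> T \<and> T \<subseteq> Y \<and> (\<forall>x\<in>T. \<exists>m. \<forall>y\<in>Y. agree m x y \<longrightarrow> y \<in> T)"
    then obtain m where "\<forall>y\<in>Y. agree m x y \<longrightarrow> y \<in> T" by blast
    then show "\<exists>y\<noteq>x. y \<in> S \<and> y \<in> T" using r by blast
  qed
qed

lemma limitin_shift_topology:
  assumes "limitin (shift_topology A) f l sequentially"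
  shows "\<exists>k0. \<forall>k\<ge>k0. agree m l (f k)"
proof -
  have "l \<in> {y. (\<forall>i. y i \<in> A) \<and> agree m l y}"
    using assms by (simp add: limitin_def topspace_shift_topology)
  then have "\<forall>\<^sub>F k in sequentially. f k \<in> {y. (\<forall>i. y i \<in> A) \<and> agree m l y}"
    using assms openin_cylinder unfolding limitin_def by blast
  then show ?thesis by (auto simp: eventually_sequentially)
qed

lemma limitin_shift_topologyI:
  assumes "\<And>i. l i \<in> A" "\<And>k i. f k i \<in> A" "\<And>m. \<exists>k0. \<forall>k\<ge>k0. agree m l (f k)"
  shows "limitin (shift_topology A) f l sequentially"
  unfolding limitin_def
proof (intro conjI allI impI)
  fix U assume "openin (shift_topology A) U \<and> l \<in> U"
  then obtain m where m: "\<forall>y. (\<forall>i. y i \<in> A) \<and> agree m l y \<longrightarrow> y \<in> U"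
    unfolding openin_shift_topology_iff by blast
  then show "\<forall>\<^sub>F k in sequentially. f k \<in> U"
    using assms(2) assms(3)[of m] unfolding eventually_sequentially by metis
qed (use assms in \<open>simp add: topspace_shift_topology\<close>)

text \<open>The easy half of the Curtis-Hedlund-Lyndon theorem: a sliding block map is continuous,
  because its values on \<open>[-m, m]\<close> are determined by the argument on an interval larger
  by the radius on both sides.\<close>

lemma endomorphismI_local:
  assumes X: "X \<subseteq> {x. \<forall>i. x i \<in> A}"
    and into: "\<And>x. x \<in> X \<Longrightarrow> \<tau> x \<in> X"
    and equi: "\<And>x. x \<in> X \<Longrightarrow> \<tau> (shift x) = shift (\<tau> x)"
    and loc: "\<And>x y k. x \<in> X \<Longrightarrow> y \<in> X \<Longrightarrow> (\<And>j. \<bar>j - k\<bar> \<le> r \<Longrightarrow> x j = y j) \<Longrightarrow> \<tau> x k = \<tau> y k"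
  shows "endomorphism A X \<tau>"
  unfolding endomorphism_def continuous_map
proof (intro conjI allI impI ballI)
  fix U assume U: "openin (subtopology (shift_topology A) X) U"
  show "openin (subtopology (shift_topology A) X)
     {x \<in> topspace (subtopology (shift_topology A) X). \<tau> x \<in> U}"
    unfolding openin_subtopology_shift_iff[OF X] topspace_subtopology_shift[OF X]
  proof (intro conjI ballI)
    fix x assume "x \<in> {x \<in> X. \<tau> x \<in> U}"
    then obtain m where x: "x \<in> X" and m: "\<forall>y\<in>X. agree m (\<tau> x) y \<longrightarrow> y \<in> U"
      using U unfolding openin_subtopology_shift_iff[OF X] by blast
    have "agree m (\<tau> x) (\<tau> y)" if "y \<in> X" "agree (m + nat \<bar>r\<bar>) x y" for y
      unfolding agree_def
    proof (intro allI impI)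
      fix k assume "\<bar>k\<bar> \<le> int m"
      then show "\<tau> x k = \<tau> y k"
      proof (intro loc x that(1))
        fix j assume "\<bar>j - k\<bar> \<le> r"
        with \<open>\<bar>k\<bar> \<le> int m\<close> have "\<bar>j\<bar> \<le> int (m + nat \<bar>r\<bar>)" by linarith
        then show "x j = y j" using that(2) unfolding agree_def by blast
      qed
    qed
    then show "\<exists>m. \<forall>y\<in>X. agree m x y \<longrightarrow> y \<in> {x \<in> X. \<tau> x \<in> U}"
      using m into by blast
  qed blast
qed (use into equi topspace_subtopology_shift[OF X] in \<open>simp_all add: image_subset_iff\<close>)

subsection \<open>Cantor-Bendixson rank at most two\<close>

lemma cb_rank_le_two_if_derived_empty:
  assumes "t1_space T" "T derived_set_of (T derived_set_of topspace T) = {}"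
  shows "cb_rank T \<le> osucc (osucc 0)"
proof -
  have 2: "cb_derivative T (osucc (osucc 0)) = {}"
    using assms(2) by (simp add: cb_derivative_osucc cb_derivative_0)
  then have "cb_derivative T (osucc (osucc (osucc 0))) = cb_derivative T (osucc (osucc 0))"
    by (subst cb_derivative_osucc) simp
  then show ?thesis
    unfolding cb_rank_def using cb_derivative_constant[OF assms(1)] by (intro Least_le) blast
qed

text \<open>If the rank is at most two, the indices two and three both lie where the derivatives are
  constant, so the second derivative is its own derived set.\<close>

lemma derived_fixed_if_cb_rank_le_two:
  fixes T :: "'b topology"
  assumes "t1_space T" "cb_rank T \<le> osucc (osucc 0)"
  defines "Y \<equiv> T derived_set_of (T derived_set_of topspace T)"
  shows "T derived_set_of Y = Y" "closedin T Y"
proof -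
  let ?two = "osucc (osucc 0) :: 'b ordinal"
  have Y: "cb_derivative T ?two = Y"
    by (simp add: Y_def cb_derivative_osucc cb_derivative_0)
  have st: "\<forall>\<alpha>\<ge>cb_rank T. cb_derivative T \<alpha> = cb_derivative T (cb_rank T)"
    unfolding cb_rank_def using cb_derivative_stabilises[OF assms(1)] by (rule LeastI_ex)
  moreover have "cb_rank T \<le> osucc ?two"
    using assms(2) less_osucc[of ?two] by (meson order_less_imp_le order_trans)
  ultimately have "cb_derivative T (osucc ?two) = cb_derivative T ?two"
    using assms(2) by metis
  then show "T derived_set_of Y = Y" unfolding cb_derivative_osucc[of T ?two] Y .
  show "closedin T Y" using closedin_cb_derivative_antimono[OF assms(1), of ?two] Y by metis
qed

text \<open>No singleton is open in a perfect set. If \<open>Y\<close> were countable, it would be a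
  countable union of closed sets with empty interior, and Baire's theorem for the compact Hausdorff
  space \<open>Y\<close> would make \<open>Y\<close> empty.\<close>

lemma perfect_closedin_uncountable:
  assumes T: "compact_space T" "Hausdorff_space T"
    and Y: "closedin T Y" "T derived_set_of Y = Y" "Y \<noteq> {}"
  shows "uncountable Y"
proof
  assume cnt: "countable Y"
  let ?S = "subtopology T Y"
  have top: "topspace ?S = Y" using Y(1) closedin_subset by fastforce
  have comp: "compact_space ?S" and haus: "Hausdorff_space ?S"
    using T Y(1) by (auto intro: closedin_compact_space compact_space_subtopology Hausdorff_space_subtopology)
  have reg: "locally_compact_space ?S \<and> regular_space ?S"
    using comp haus by (simp add: compact_imp_locally_compact_space compact_Hausdorff_imp_regular_space)
  have "?S interior_of \<Union> ((\<lambda>y. {y}) ` Y) = {}"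
  proof (rule Baire_category_alt)
    fix G assume "G \<in> (\<lambda>y. {y}) ` Y"
    then obtain y where y: "y \<in> Y" "G = {y}" by blast
    have "closedin ?S {y}"
      using haus y top by (simp add: closedin_Hausdorff_singleton)
    moreover have "\<not> openin ?S {y}"
    proof
      assume "openin ?S {y}"
      then obtain V where "openin T V" "{y} = V \<inter> Y" by (auto simp: openin_subtopology)
      moreover have "y \<in> T derived_set_of Y" using y Y(2) by simp
      ultimately show False unfolding in_derived_set_of by blast
    qed
    then have "?S interior_of {y} = {}"
      by (metis interior_of_eq_empty subset_singletonD)
    ultimately show "closedin ?S G \<and> ?S interior_of G = {}" using y by blast
  qed (use cnt reg in auto)
  moreover have "?S interior_of \<Union> ((\<lambda>y. {y}) ` Y) = Y"
    using top by (metis UN_singleton interior_of_topspace)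
  ultimately show False using Y(3) by simp
qed

section \<open>Windows of fixed length and the reachability relation\<close>

locale window_subshift =
  fixes A :: "'a set" and X :: "(int \<Rightarrow> 'a) set" and n :: nat
  assumes finite_A: "finite A" and n_pos: "0 < n"
    and X_A: "x \<in> X \<Longrightarrow> x i \<in> A"
    and translate_X: "x \<in> X \<Longrightarrow> translate k x \<in> X"
    and window_X: "(\<And>i. \<exists>y\<in>X. \<forall>k. i \<le> k \<and> k < i + int n \<longrightarrow> x k = y k) \<Longrightarrow> x \<in> X"
begin

text \<open>Unlike \<open>window\<close>, this word starts at \<open>i\<close> itself; with
  \<open>n_pos\<close> it always contains the letter at \<open>i\<close>.\<close>

definition W :: "(int \<Rightarrow> 'a) \<Rightarrow> int \<Rightarrow> 'a list" where
  "W x i = map (\<lambda>k. x (i + int k)) [0..<n]"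

definition words :: "'a list set" where
  "words = {w. set w \<subseteq> A \<and> length w = n}"

text \<open>The strict inequality makes \<open>reach w w\<close> say that \<open>w\<close> can occur
  twice in one point: this is recurrence of a window.\<close>

definition reach :: "'a list \<Rightarrow> 'a list \<Rightarrow> bool" where
  "reach v w \<longleftrightarrow> (\<exists>x\<in>X. \<exists>i j. i < j \<and> W x i = v \<and> W x j = w)"

lemma X_subset: "X \<subseteq> {x. \<forall>i. x i \<in> A}"
  using X_A by blast

lemma W_eq_iff: "W x i = W y j \<longleftrightarrow> (\<forall>k. 0 \<le> k \<and> k < int n \<longrightarrow> x (i + k) = y (j + k))"
proof -
  have "W x i = W y j \<longleftrightarrow> (\<forall>m<n. x (i + int m) = y (j + int m))"
    by (auto simp: W_def)
  also have "\<dots> \<longleftrightarrow> (\<forall>k. 0 \<le> k \<and> k < int n \<longrightarrow> x (i + k) = y (j + k))"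
  proof (intro iffI allI impI)
    fix k assume "\<forall>m<n. x (i + int m) = y (j + int m)" "0 \<le> k \<and> k < int n"
    then show "x (i + k) = y (j + k)" by (auto dest: spec[of _ "nat k"])
  qed simp
  finally show ?thesis .
qed

lemma W_eqI: "(\<And>k. i \<le> k \<Longrightarrow> k < i + int n \<Longrightarrow> x k = y k) \<Longrightarrow> W x i = W y i"
  by (simp add: W_eq_iff)

lemma W_eqD: "W x i = W y i \<Longrightarrow> i \<le> k \<Longrightarrow> k < i + int n \<Longrightarrow> x k = y k"
  unfolding W_eq_iff by (auto dest: spec[of _ "k - i"])

lemma W_translate [simp]: "W (translate k x) i = W x (i + k)"
  by (simp add: W_def add_ac)

lemma finite_words: "finite words"
  unfolding words_def using finite_A by (rule finite_lists_length_eq)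

lemma W_in_words: "x \<in> X \<Longrightarrow> W x i \<in> words"
  using X_A by (auto simp: words_def W_def)

lemma reachI: "x \<in> X \<Longrightarrow> i < j \<Longrightarrow> reach (W x i) (W x j)"
  unfolding reach_def by blast

lemma reach_words: "reach v w \<Longrightarrow> v \<in> words \<and> w \<in> words"
  unfolding reach_def using W_in_words by blast

subsection \<open>Splicing and closing up\<close>

text \<open>The two points share the \<open>n\<close> letters from \<open>i\<close> on, so the
  spliced point still equals \<open>x\<close> on these.\<close>

lemma splice_left:
  assumes "W x i = W y i" "k < i + int n"
  shows "splice_at i x y k = x k"
  using W_eqD[OF assms(1), of k] assms(2) by (simp add: splice_at_def)

lemma splice_right: "i \<le> k \<Longrightarrow> splice_at i x y k = y k"
  by (simp add: splice_at_def)

lemma W_splice_left: "W x i = W y i \<Longrightarrow> j \<le> i \<Longrightarrow> W (splice_at i x y) j = W x j"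
  by (rule W_eqI) (simp add: splice_left)

lemma W_splice_right: "i \<le> j \<Longrightarrow> W (splice_at i x y) j = W y j"
  by (rule W_eqI) (simp add: splice_right)

text \<open>Each stretch of \<open>n\<close> letters lies in the part taken from \<open>x\<close>,
  prolonged by the overlap, or in the part taken from \<open>y\<close>.\<close>

lemma splice_X:
  assumes "x \<in> X" "y \<in> X" "W x i = W y i"
  shows "splice_at i x y \<in> X"
proof (rule window_X)
  fix j
  show "\<exists>z\<in>X. \<forall>k. j \<le> k \<and> k < j + int n \<longrightarrow> splice_at i x y k = z k"
  proof (cases "j \<le> i")
    case True
    then show ?thesis using assms by (intro bexI[of _ x]) (auto simp: splice_left)
  next
    case False
    then show ?thesis using assms by (intro bexI[of _ y]) (auto simp: splice_right)
  qed
qed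

text \<open>A point witnessing \<open>reach v w\<close> is translated so that its \<open>v\<close>
  sits at \<open>i\<close>, then spliced to \<open>x\<close> there.\<close>

lemma reach_extend_right:
  assumes "reach v w" "x \<in> X" "W x i = v"
  obtains y j where "y \<in> X" "i < j" "W y j = w" "\<And>k. k < i + int n \<Longrightarrow> y k = x k"
proof -
  obtain z a b where z: "z \<in> X" "a < b" "W z a = v" "W z b = w"
    using assms(1) unfolding reach_def by blast
  let ?z = "translate (a - i) z"
  have eq: "W x i = W ?z i" using assms(3) z(3) by simp
  show thesis
  proof (rule that[of "splice_at i x ?z" "b - a + i"])
    show "splice_at i x ?z \<in> X" using assms(2) z(1) eq by (intro splice_X translate_X)
    show "W (splice_at i x ?z) (b - a + i) = w" using z(2,4) by (simp add: W_splice_right)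
  qed (use z(2) eq splice_left in auto)
qed

lemma reach_extend_left:
  assumes "reach v w" "x \<in> X" "W x j = w"
  obtains y i where "y \<in> X" "i < j" "W y i = v" "\<And>k. j \<le> k \<Longrightarrow> y k = x k"
proof -
  obtain z a b where z: "z \<in> X" "a < b" "W z a = v" "W z b = w"
    using assms(1) unfolding reach_def by blast
  let ?z = "translate (b - j) z"
  have eq: "W ?z j = W x j" using assms(3) z(4) by simp
  show thesis
  proof (rule that[of "splice_at j ?z x" "a - b + j"])
    show "splice_at j ?z x \<in> X" using assms(2) z(1) eq by (intro splice_X translate_X)
    show "W (splice_at j ?z x) (a - b + j) = v" using z(2,3) eq by (simp add: W_splice_left)
  qed (use z(2) splice_right in auto)
qed

lemma reach_trans:
  assumes "reach u v" "reach v w"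
  shows "reach u w"
proof -
  obtain x i j where x: "x \<in> X" "i < j" "W x i = u" "W x j = v"
    using assms(1) unfolding reach_def by blast
  obtain y l where y: "y \<in> X" "j < l" "W y l = w" "\<And>k. k < j + int n \<Longrightarrow> y k = x k"
    using reach_extend_right[OF assms(2) x(1) x(4)] by metis
  have "W y i = u" using x y(4) by (simp add: W_eqI[of i y x])
  then show ?thesis using reachI[OF y(1), of i l] x(2) y(2,3) by simp
qed

text \<open>The stretch of \<open>h\<close> from \<open>a\<close> to \<open>a + P\<close> is
  repeated. Because the window at \<open>a\<close> recurs at \<open>a + P\<close>, every window of
  the repetition is a window of a translate of \<open>h\<close>.\<close>

lemma periodize:
  assumes h: "h \<in> X" "0 < P" "W h a = W h (a + P)"
  obtains p where "p \<in> X" "periodic P p" "\<And>k. a \<le> k \<Longrightarrow> k < a + P + int n \<Longrightarrow> p k = h k"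
proof -
  define p where "p k = h (a + (k - a) mod P)" for k
  \<comment> \<open>\<open>h\<close> is \<open>P\<close>-periodic on the whole stretch up to
    \<open>a + P + n\<close>: equality of the two windows allows going back by \<open>P\<close> as
    long as the offset is at least \<open>P\<close>.\<close>
  have red: "h (a + int j) = h (a + int j mod P)" if "int j < P + int n" for j
    using that
  proof (induction j rule: less_induct)
    case (less j)
    show ?case
    proof (cases "int j < P")
      case False
      let ?l = "nat (int j - P)"
      have l: "int ?l = int j - P" "?l < j" using False h(2) by auto
      have "h (a + int j) = h (a + int ?l)"
        using h(3) less.prems False unfolding W_eq_iff l
        by (auto dest!: spec[of _ "int j - P"])
      also have "\<dots> = h (a + int ?l mod P)" using less.IH[of ?l] l less.prems h(2) by auto
      finally show ?thesis by (simp add: l)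
    qed (use h in simp)
  qed
  \<comment> \<open>Subtracting the multiple of \<open>P\<close> that brings \<open>j\<close> into
    the first period moves the window at \<open>j\<close> into the stretch covered by
    \<open>red\<close>.\<close>
  have eq: "p k = h (k - P * ((j - a) div P))" if "j \<le> k" "k < j + int n" for j k
  proof -
    let ?m = "k - a - P * ((j - a) div P)"
    have j: "(j - a) mod P = j - a - P * ((j - a) div P)"
      by (simp add: minus_mult_div_eq_mod)
    then have "0 \<le> ?m" "?m < P + int n"
      using that pos_mod_sign[OF h(2), of "j - a"] pos_mod_bound[OF h(2), of "j - a"] by linarith+
    then have "h (a + ?m) = h (a + ?m mod P)" using red[of "nat ?m"] by simp
    moreover have "?m mod P = (k - a) mod P"
      using mod_mult_self2[of ?m P "(j - a) div P"] by simp
    ultimately show ?thesis by (simp add: p_def)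
  qed
  show thesis
  proof (rule that[of p])
    show "p \<in> X"
    proof (rule window_X)
      fix j
      show "\<exists>y\<in>X. \<forall>k. j \<le> k \<and> k < j + int n \<longrightarrow> p k = y k"
        using eq[of j] translate_X[OF h(1), of "- (P * ((j - a) div P))"]
        by (intro bexI[of _ "translate (- (P * ((j - a) div P))) h"]) auto
    qed
    show "periodic P p"
      unfolding periodic_def p_def by (simp add: diff_add_eq[symmetric])
    fix k assume k: "a \<le> k" "k < a + P + int n"
    then show "p k = h k" using red[of "nat (k - a)"] by (simp add: p_def)
  qed
qed

text \<open>Beyond \<open>b\<close> the point is extended back to the window at \<open>a\<close>,
  and the resulting loop is repeated.\<close>

lemma close_up:
  assumes "x \<in> X" "a \<le> b" "reach (W x b) (W x a)"
  obtains p T where "p \<in> X" "0 < T" "periodic T p" "\<And>k. a \<le> k \<Longrightarrow> k < b + int n \<Longrightarrow> p k = x k"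
proof -
  obtain h j where h: "h \<in> X" "b < j" "W h j = W x a" "\<And>k. k < b + int n \<Longrightarrow> h k = x k"
    using reach_extend_right[OF assms(3,1) refl] by metis
  have "W h a = W x a" using h(4) assms(2) by (intro W_eqI) simp
  then obtain p where "p \<in> X" "periodic (j - a) p"
      "\<And>k. a \<le> k \<Longrightarrow> k < a + (j - a) + int n \<Longrightarrow> p k = h k"
    using periodize[OF h(1), of "j - a" a] h(2,3) assms(2) by auto
  then show thesis using that[of p "j - a"] h assms(2) by auto
qed

lemma recurrent_periodic:
  assumes "reach w w"
  obtains p T where "p \<in> X" "0 < T" "periodic T p" "W p i = w"
proof -
  obtain x j l where x: "x \<in> X" "W x j = w"
    using assms unfolding reach_def by blast
  have "reach (W x j) (W x j)" using assms x by simp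
  then obtain p T where p: "p \<in> X" "0 < T" "periodic T p" "\<And>k. j \<le> k \<Longrightarrow> k < j + int n \<Longrightarrow> p k = x k"
    using close_up[OF x(1) order_refl] by metis
  have "W p j = w" using p(4) x(2) W_eqI by metis
  then show thesis
    using that[of "translate (j - i) p" T] p by (simp add: translate_X periodic_translate)
qed

lemma W_periodic: "periodic T p \<Longrightarrow> W p (i + T * m) = W p i"
  unfolding W_eq_iff using periodic_mult[of T p] by (simp add: add.assoc add.commute[of "T * m"]) (simp flip: add.assoc)

lemma periodic_reach:
  assumes "p \<in> X" "0 < T" "periodic T p"
  shows "reach (W p i) (W p j)"
proof -
  define N where "N = \<bar>i - j\<bar> + 1"
  have "1 * N \<le> T * N"
    using assms(2) by (intro mult_right_mono) (auto simp: N_def)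
  moreover have "i < j + N" by (simp add: N_def)
  ultimately have "i < j + T * N" by linarith
  then show ?thesis using reachI[OF assms(1)] W_periodic[OF assms(3)] by metis
qed

subsection \<open>Recurrent windows along a point\<close>

text \<open>Pigeonhole: among one more position than there are words, two carry the same window,
  which is then recurrent.\<close>

lemma recurrent_window_in_interval:
  assumes "x \<in> X"
  obtains j where "k < j" "j \<le> k + int (card words) + 1" "reach (W x j) (W x j)"
proof -
  let ?I = "{k + 1..k + int (card words) + 1}"
  have "\<not> inj_on (W x) ?I"
  proof
    assume "inj_on (W x) ?I"
    then have "card ?I \<le> card words"
      using card_inj_on_le[of "W x" ?I words] finite_words W_in_words[OF assms] by blast
    then show False by simp
  qed
  then obtain i j where "i \<in> ?I" "j \<in> ?I" "i \<noteq> j" "W x i = W x j"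
    unfolding inj_on_def by blast
  then have "reach (W x i) (W x i)"
    using reachI[OF assms] by (metis linorder_neqE)
  then show thesis using that[of i] \<open>i \<in> ?I\<close> by auto
qed

text \<open>Some window occurs at infinitely many positions to the right. From one of its
  occurrences on, every window is followed and preceded by it or equals it, so all these windows
  reach each other.\<close>

lemma eventual_class_right:
  assumes "x \<in> X"
  obtains b where "\<And>i j. b \<le> i \<Longrightarrow> b \<le> j \<Longrightarrow> reach (W x i) (W x j)"
proof -
  obtain m0 where inf: "infinite {m. W x (int m) = W x (int m0)}"
    using pigeonhole_infinite[of "UNIV :: nat set" "\<lambda>m. W x (int m)"] W_in_words[OF assms]
      finite_subset[OF _ finite_words] by (auto simp: image_subset_iff)
  have cofinal: "\<exists>l>i. W x l = W x (int m0)" for i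
  proof -
    obtain m where "nat \<bar>i\<bar> < m" "W x (int m) = W x (int m0)"
      using inf unfolding infinite_nat_iff_unbounded by blast
    then show ?thesis by (intro exI[of _ "int m"]) linarith
  qed
  have "reach (W x i) (W x j)" if ij: "int m0 \<le> i" "int m0 \<le> j" for i j
  proof -
    have to: "reach (W x i) (W x (int m0))" using cofinal[of i] reachI[OF assms] by metis
    then show ?thesis
      using ij(2) reachI[OF assms, of "int m0" j] reach_trans by (cases "j = int m0") auto
  qed
  then show thesis using that by blast
qed

lemma eventual_class_left:
  assumes "x \<in> X"
  obtains b where "\<And>i j. i \<le> b \<Longrightarrow> j \<le> b \<Longrightarrow> reach (W x i) (W x j)"
proof -
  obtain m0 where inf: "infinite {m. W x (- int m) = W x (- int m0)}"
    using pigeonhole_infinite[of "UNIV :: nat set" "\<lambda>m. W x (- int m)"] W_in_words[OF assms]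
      finite_subset[OF _ finite_words] by (auto simp: image_subset_iff)
  have cofinal: "\<exists>l<i. W x l = W x (- int m0)" for i
  proof -
    obtain m where "nat \<bar>i\<bar> < m" "W x (- int m) = W x (- int m0)"
      using inf unfolding infinite_nat_iff_unbounded by blast
    then show ?thesis by (intro exI[of _ "- int m"]) linarith
  qed
  have "reach (W x i) (W x j)" if ij: "i \<le> - int m0" "j \<le> - int m0" for i j
  proof -
    have from0: "reach (W x (- int m0)) (W x j)" using cofinal[of j] reachI[OF assms] by metis
    then show ?thesis
      using ij(1) reachI[OF assms, of i "- int m0"] reach_trans by (cases "i = - int m0") auto
  qed
  then show thesis using that by blast
qed

subsection \<open>Ambiguous windows\<close>

definition ambiguous :: bool where
  "ambiguous \<longleftrightarrow> (\<exists>p\<in>X. \<exists>q\<in>X. \<exists>T>0. periodic T p \<and> periodic T q \<and> p \<noteq> q \<and> W p 0 = W q 0)"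

text \<open>Removes the normalisation in \<open>ambiguous\<close>: two periods have a common
  multiple, and a translation brings the common window to \<open>0\<close>.\<close>

lemma ambiguousI:
  assumes "p \<in> X" "q \<in> X" "0 < S" "periodic S p" "0 < T" "periodic T q" "W p i = W q i" "p \<noteq> q"
  shows ambiguous
proof -
  obtain U where U: "0 < U" "periodic U p" "periodic U q"
    using periodic_common[of S p T q] assms by blast
  have "translate i p \<noteq> translate i q"
  proof
    assume "translate i p = translate i q"
    then have "translate (- i) (translate i p) = translate (- i) (translate i q)" by simp
    then show False using assms(8) by simp
  qed
  then show ?thesis
    unfolding ambiguous_def using U assms(1,2,7)
    by (intro bexI[of _ "translate i p"] bexI[of _ "translate i q"] exI[of _ U])
      (auto simp: translate_X periodic_translate)
qed

text \<open>Closing up \<open>x\<close> from \<open>a\<close> to \<open>b\<close> gives a periodic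
  point that shares the window at \<open>c\<close> with \<open>p\<close>. Without ambiguity it is
  \<open>p\<close>: as long as a point stays in one class, it follows a single periodic
  orbit.\<close>

lemma interval_eq_periodic:
  assumes "\<not> ambiguous" "x \<in> X" "a \<le> b" "reach (W x b) (W x a)"
    and p: "p \<in> X" "0 < T" "periodic T p" and c: "a \<le> c" "c \<le> b" "W p c = W x c"
    and k: "a \<le> k" "k < b + int n"
  shows "x k = p k"
proof -
  obtain q S where q: "q \<in> X" "0 < S" "periodic S q" "\<And>k. a \<le> k \<Longrightarrow> k < b + int n \<Longrightarrow> q k = x k"
    using close_up[OF assms(2,3,4)] by metis
  have "W q c = W p c" using q(4) c by (simp add: W_eqI[of c q x])
  then have "q = p" using ambiguousI[OF q(1) p(1) q(2,3) p(2,3)] assms(1) by blast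
  then show ?thesis using q(4) k by simp
qed

subsection \<open>Irreducible components\<close>

definition comp :: "'a list \<Rightarrow> (int \<Rightarrow> 'a) set" where
  "comp w = {x \<in> X. \<forall>i. reach (W x i) w \<and> reach w (W x i)}"

text \<open>Every window of \<open>x\<close> lies to the right of one reached from \<open>w\<close>
  and to the left of one reaching \<open>w\<close>; so control of the two ends is enough.\<close>

lemma compI:
  assumes "x \<in> X" "\<And>i. \<exists>j<i. reach w (W x j)" "\<And>i. \<exists>j>i. reach (W x j) w"
  shows "x \<in> comp w"
proof -
  have "reach (W x i) w \<and> reach w (W x i)" for i
  proof -
    obtain j l where "j < i" "reach w (W x j)" "i < l" "reach (W x l) w" using assms(2,3) by meson
    then show ?thesis using reachI[OF assms(1)] reach_trans by metis
  qed
  then show ?thesis using assms(1) by (simp add: comp_def)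
qed

lemma periodic_in_comp:
  assumes "p \<in> X" "0 < T" "periodic T p"
  shows "p \<in> comp (W p i)"
  using periodic_reach[OF assms] assms(1) by (simp add: comp_def)

lemma comp_nonempty: "reach w w \<Longrightarrow> comp w \<noteq> {}"
  using recurrent_periodic[of w 0] periodic_in_comp[of _ _ 0] by auto

lemma comp_eq: "reach v w \<Longrightarrow> reach w v \<Longrightarrow> comp v = comp w"
  unfolding comp_def using reach_trans by blast

lemma in_comp_reach: "x \<in> comp w \<Longrightarrow> reach (W x i) (W x j)"
  unfolding comp_def using reach_trans by blast

lemma in_comp_eq:
  assumes "x \<in> comp v" "x \<in> comp w"
  shows "reach v w" "comp v = comp w"
  using assms comp_eq[of v w] reach_trans unfolding comp_def by blast+

lemma comp_eq_iff:
  assumes "reach v v" "reach w w"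
  shows "comp v = comp w \<longleftrightarrow> reach v w \<and> reach w v"
  using comp_nonempty[OF assms(1)] in_comp_eq(1) comp_eq by blast

lemma closedin_comp: "closedin (shift_topology A) (comp w)"
  unfolding closedin_shift_topology_iff
proof (intro conjI allI impI)
  show "comp w \<subseteq> {x. \<forall>i. x i \<in> A}" using X_A by (auto simp: comp_def)
  fix x assume x: "(\<forall>i. x i \<in> A) \<and> (\<forall>m. \<exists>y\<in>comp w. agree m x y)"
  have appr: "\<exists>y\<in>comp w. \<forall>k. i \<le> k \<and> k < i + int n \<longrightarrow> x k = y k" for i
  proof -
    obtain y where "y \<in> comp w" "agree (nat \<bar>i\<bar> + n) x y" using x by blast
    then show ?thesis unfolding agree_def by (intro bexI[of _ y]) auto
  qed
  have "x \<in> X" using appr unfolding comp_def by (intro window_X) blast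
  moreover have "reach (W x i) w \<and> reach w (W x i)" for i
  proof -
    obtain y where "y \<in> comp w" "W x i = W y i" using appr[of i] W_eqI by metis
    then show ?thesis by (simp add: comp_def)
  qed
  ultimately show "x \<in> comp w" by (simp add: comp_def)
qed

lemma translate_comp: "x \<in> comp w \<Longrightarrow> translate k x \<in> comp w"
  by (simp add: comp_def translate_X)

lemma subshift_comp: "subshift A (comp w)"
proof -
  have "x \<in> shift ` comp w" if "x \<in> comp w" for x
    using translate_comp[OF that, of "- 1"] by (intro image_eqI[of _ _ "translate (- 1) x"]) (auto simp: shift_eq_translate)
  then show ?thesis
    using closedin_comp translate_comp unfolding subshift_def shift_eq_translate by blast
qed

lemma comp_subset: "comp w \<subseteq> {x. \<forall>i. x i \<in> A}"
  using X_A by (auto simp: comp_def)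

text \<open>The witness is a point that follows \<open>y\<close> past its central window, moves on
  to a window of \<open>x\<close>, and follows \<open>x\<close> from there.\<close>

lemma irreducible_comp:
  assumes "reach w w"
  shows "irreducible_subshift A (comp w)"
  unfolding irreducible_subshift_def
proof (intro conjI allI impI)
  fix U V
  assume "openin (subtopology (shift_topology A) (comp w)) U \<and> U \<noteq> {} \<and>
       openin (subtopology (shift_topology A) (comp w)) V \<and> V \<noteq> {}"
  then obtain x y k l where xy: "x \<in> U" "y \<in> V" "x \<in> comp w" "y \<in> comp w"
    and k: "\<forall>z\<in>comp w. agree k x z \<longrightarrow> z \<in> U" and l: "\<forall>z\<in>comp w. agree l y z \<longrightarrow> z \<in> V"
    unfolding openin_subtopology_shift_iff[OF comp_subset] by blast
  define m where "m = max k l"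
  have X: "x \<in> X" "y \<in> X" using xy by (auto simp: comp_def)
  have "reach (W y (int m + 1)) (W x (- int m))"
    using xy reach_trans unfolding comp_def by blast
  \<comment> \<open>\<open>z\<close> arrives at \<open>j\<close> at the window with which the
    central stretch of \<open>x\<close> begins; \<open>x\<close> is translated so that this window
    sits at \<open>j\<close> too.\<close>
  from reach_extend_right[OF this X(2) refl]
  obtain z j where z: "z \<in> X" "int m + 1 < j" "W z j = W x (- int m)"
    "\<And>i. i < int m + 1 + int n \<Longrightarrow> z i = y i" by metis
  let ?x = "translate (- int m - j) x"
  define u where "u = splice_at j z ?x"
  have eq: "W z j = W ?x j" using z(3) by simp
  have uX: "u \<in> X" unfolding u_def using z(1) X eq by (intro splice_X translate_X)
  have uy: "u i = y i" if "i < int m + 1 + int n" for i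
    using that z(2,4) splice_left[OF eq] by (simp add: u_def)
  have ux: "u i = ?x i" if "j \<le> i" for i
    using that by (simp add: u_def splice_right)
  have u: "u \<in> comp w"
  proof (rule compI[OF uX])
    fix i
    let ?a = "min (i - 1) 0" and ?b = "max (i + 1) j"
    have "W u ?a = W y ?a" by (intro W_eqI uy) auto
    then have "reach w (W u ?a)" using xy by (simp add: comp_def)
    then show "\<exists>j<i. reach w (W u j)" by (intro exI[of _ ?a]) simp
    have "W u ?b = W ?x ?b" by (intro W_eqI ux) auto
    then have "reach (W u ?b) w" using xy by (simp add: comp_def)
    then show "\<exists>j>i. reach (W u j) w" by (intro exI[of _ ?b]) simp
  qed
  have "agree l y u" using uy by (simp add: agree_def m_def)
  then have "u \<in> V" using l u by blast
  \<comment> \<open>The central stretch of \<open>x\<close> starts at \<open>- m\<close> and is seen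
    in \<open>u\<close> at \<open>j\<close>; the difference is the number of shifts.\<close>
  define N where "N = nat (j + int m)"
  have N: "int N = j + int m" "1 \<le> N" using z(2) by (auto simp: N_def)
  have "agree k x (translate (int N) u)" using ux N by (auto simp: agree_def m_def)
  then have "(shift ^^ N) u \<in> U" using k u translate_comp by (simp add: shift_funpow)
  then show "\<exists>n\<ge>1. U \<inter> (shift ^^ n) ` V \<noteq> {}" using N(2) \<open>u \<in> V\<close> by blast
qed (use subshift_comp comp_nonempty assms in auto)

text \<open>A return to a small neighborhood of \<open>x\<close> gives a point \<open>z\<close> with
  the same central stretch at \<open>0\<close> and at \<open>N\<close>. If \<open>N\<close> exceeds
  \<open>j - i\<close>, then \<open>z\<close> leads from the window \<open>j\<close> of the first
  copy to the window \<open>i\<close> of the second. Otherwise the copies overlap, the windows of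
  \<open>x\<close> at \<open>j\<close> and \<open>j - N\<close> are equal, and induction
  applies.\<close>

lemma NW_reach:
  assumes x: "x \<in> NW A X" and "i \<le> j"
  shows "reach (W x j) (W x i)"
  using assms(2)
proof (induction "nat (j - i)" arbitrary: j rule: less_induct)
  case less
  define m where "m = nat (\<bar>i\<bar> + \<bar>j\<bar>) + n"
  let ?U = "{y \<in> X. agree m x y}"
  have "openin (subtopology (shift_topology A) X) ?U"
    unfolding openin_subtopology_shift_iff[OF X_subset]
  proof (intro conjI ballI exI[of _ m] impI)
    fix y z assume "y \<in> ?U" "z \<in> X" "agree m y z"
    then show "z \<in> ?U" by (simp add: agree_def)
  qed blast
  then have "neighborhood_in (subtopology (shift_topology A) X) x ?U"
    using x topspace_subtopology_shift[OF X_subset]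
    unfolding neighborhood_in_def by (intro conjI exI[of _ ?U]) (simp_all add: NW_def subset_iff)
  then obtain N where N: "1 \<le> N" "?U \<inter> (shift ^^ N) ` ?U \<noteq> {}" using x unfolding NW_def by simp blast
  then obtain z where z: "z \<in> X" "agree m x z" "agree m x (translate (int N) z)"
    by (auto simp: shift_funpow)
  have eq: "W z l = W x l" "W z (l + int N) = W x l" if "i \<le> l" "l \<le> j" for l
  proof -
    have "\<bar>k\<bar> \<le> int m" if "l \<le> k" "k < l + int n" for k
      using that \<open>i \<le> l\<close> \<open>l \<le> j\<close> by (simp add: m_def)
    then have "W x l = W z l" "W x l = W (translate (int N) z) l"
      using z(2,3) unfolding agree_def by (intro W_eqI; blast)+
    then show "W z l = W x l" "W z (l + int N) = W x l" by auto
  qed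
  show ?case
  proof (cases "j < i + int N")
    case True
    then show ?thesis using reachI[OF z(1) True] eq[of i] eq[of j] less.prems by simp
  next
    case False
    then have "W x j = W x (j - int N)"
      using eq(2)[of "j - int N"] eq(1)[of j] N(1) less.prems by simp
    moreover have "reach (W x (j - int N)) (W x i)"
      using less.hyps[of "j - int N"] False N(1) by simp
    ultimately show ?thesis by simp
  qed
qed

text \<open>\<open>NW_reach\<close> puts all windows of a non-wandering point into one class.
  Conversely, closing up a long central stretch of a point of a component gives a periodic point in
  any given neighborhood, and this point returns to itself.\<close>

lemma NW_eq: "NW A X = \<Union> {comp w | w. reach w w}"
proof (intro equalityI subsetI)
  fix x assume x: "x \<in> NW A X"
  then have xX: "x \<in> X" by (simp add: NW_def)
  have "reach (W x i) (W x j)" for i j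
    using NW_reach[OF x] reachI[OF xX] by (meson linorder_not_less)
  then have "x \<in> comp (W x 0)" "reach (W x 0) (W x 0)" using xX by (auto simp: comp_def)
  then show "x \<in> \<Union> {comp w | w. reach w w}" by blast
next
  fix x assume "x \<in> \<Union> {comp w | w. reach w w}"
  then obtain w where w: "x \<in> comp w" by blast
  then have x: "x \<in> X" by (simp add: comp_def)
  show "x \<in> NW A X"
    unfolding NW_def mem_Collect_eq
  proof (intro conjI allI impI x)
    fix U assume U: "neighborhood_in (subtopology (shift_topology A) X) x U"
    then obtain m where m: "\<forall>y\<in>X. agree m x y \<longrightarrow> y \<in> U"
      unfolding neighborhood_in_def openin_subtopology_shift_iff[OF X_subset] by blast
    obtain p T where p: "p \<in> X" "0 < T" "periodic T p"
      "\<And>k. - int m \<le> k \<Longrightarrow> k < int m + 1 + int n \<Longrightarrow> p k = x k"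
      using close_up[OF x, of "- int m" "int m + 1"] in_comp_reach[OF w] by auto
    have "agree m x p" using p(4) by (simp add: agree_def)
    then have "p \<in> U" using m p(1) by blast
    moreover have "(shift ^^ nat T) p = p"
      using p(2,3) by (simp add: shift_funpow periodic_def translate_def)
    ultimately have "p \<in> U \<inter> (shift ^^ nat T) ` U" by (metis IntI imageI)
    then show "\<exists>n\<ge>1. U \<inter> (shift ^^ n) ` U \<noteq> {}" using p(2) by (intro exI[of _ "nat T"]) auto
  qed
qed

lemma partition_comps:
  "finite {comp w | w. reach w w}" "partition_on (NW A X) {comp w | w. reach w w}"
  "\<forall>C\<in>{comp w | w. reach w w}. irreducible_subshift A C"
proof -
  have "{comp w | w. reach w w} \<subseteq> comp ` words" using reach_words by blast
  then show "finite {comp w | w. reach w w}" using finite_words finite_subset by blast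
  show "partition_on (NW A X) {comp w | w. reach w w}"
  proof (rule partition_onI)
    fix C D assume "C \<in> {comp w | w. reach w w}" "D \<in> {comp w | w. reach w w}" "C \<noteq> D"
    then show "disjnt C D" using in_comp_eq(2) unfolding disjnt_iff by blast
  qed (use NW_eq comp_nonempty in auto)
qed (use irreducible_comp in blast)

end

section \<open>Uniqueness of the partition into irreducible subshifts\<close>

lemma irreducible_subshiftD:
  assumes "irreducible_subshift A C"
  shows "subshift A C" "C \<noteq> {}"
    and "openin (subtopology (shift_topology A) C) U \<Longrightarrow> U \<noteq> {} \<Longrightarrow>
         openin (subtopology (shift_topology A) C) V \<Longrightarrow> V \<noteq> {} \<Longrightarrow>
         \<exists>m. U \<inter> (shift ^^ m) ` V \<noteq> {}"
proof -
  show "subshift A C" "C \<noteq> {}" using assms by (simp_all add: irreducible_subshift_def)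
  assume *: "openin (subtopology (shift_topology A) C) U" "U \<noteq> {}"
    "openin (subtopology (shift_topology A) C) V" "V \<noteq> {}"
  have "\<exists>m\<ge>1. U \<inter> (shift ^^ m) ` V \<noteq> {}"
    using assms * unfolding irreducible_subshift_def by simp
  then show "\<exists>m. U \<inter> (shift ^^ m) ` V \<noteq> {}" by blast
qed

text \<open>A part \<open>S\<close> that meets \<open>C\<close> splits \<open>C\<close> into two
  relatively open sets, since the finitely many parts are closed. No orbit passes from one set to
  the other, as \<open>S\<close> is invariant; so irreducibility forces \<open>C - S\<close> to be
  empty.\<close>

lemma irreducible_subset_part:
  assumes D: "finite D" "disjoint D" "\<forall>S\<in>D. subshift A S"
    and C: "irreducible_subshift A C" "C \<subseteq> \<Union>D"
  shows "\<exists>S\<in>D. C \<subseteq> S"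
proof -
  obtain x S where x: "x \<in> C" "S \<in> D" "x \<in> S"
    using C(2) irreducible_subshiftD(2)[OF C(1)] by blast
  have CA: "C \<subseteq> topspace (shift_topology A)"
    using irreducible_subshiftD(1)[OF C(1)] closedin_subset unfolding subshift_def by blast
  let ?T = "subtopology (shift_topology A) C"
  let ?R = "\<Union>(D - {S})"
  have cl: "closedin (shift_topology A) S" "closedin (shift_topology A) ?R"
    using D x(2) by (auto simp: subshift_def intro!: closedin_Union)
  have disj: "S \<inter> ?R = {}" using D(2) x(2) by (auto simp: disjoint_def)
  have "openin ?T (C \<inter> S)"
  proof -
    have "openin ?T (C \<inter> (topspace (shift_topology A) - ?R))"
      using cl(2) by (intro openin_subtopology_Int2) (simp add: openin_diff)
    moreover have "C \<inter> (topspace (shift_topology A) - ?R) = C \<inter> S"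
      using C(2) CA disj by blast
    ultimately show ?thesis by simp
  qed
  moreover have "openin ?T (C - S)"
  proof -
    have "openin ?T (C \<inter> (topspace (shift_topology A) - S))"
      using cl(1) by (intro openin_subtopology_Int2) (simp add: openin_diff)
    moreover have "C \<inter> (topspace (shift_topology A) - S) = C - S"
      using CA by blast
    ultimately show ?thesis by simp
  qed
  moreover have "C \<inter> S \<inter> (shift ^^ m) ` (C - S) = {}" for m
  proof -
    have pull: "y \<in> S" if sy: "shift y \<in> S" for y
    proof -
      have "shift ` S = S" using D(3) x(2) by (simp add: subshift_def)
      then obtain z where "z \<in> S" "shift y = shift z" using sy by (metis imageE)
      moreover have "y = z"
        using arg_cong[OF \<open>shift y = shift z\<close>, of "translate (- 1)"] by (simp add: shift_eq_translate)
      ultimately show ?thesis by simp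
    qed
    have "y \<in> S" if "(shift ^^ m) y \<in> S" for y
      using that
    proof (induction m)
      case (Suc m)
      then show ?case using pull[of "(shift ^^ m) y"] by simp
    qed simp
    then show ?thesis by blast
  qed
  ultimately have "C - S = {}"
    using irreducible_subshiftD(3)[OF C(1), of "C \<inter> S" "C - S"] x by blast
  then show ?thesis using x(2) by blast
qed

text \<open>Each part of one partition lies in a part of the other, which in turn lies in a part of
  the first; disjointness makes the three equal.\<close>

lemma irreducible_partition_unique:
  assumes "finite P" "partition_on N P" "\<forall>C\<in>P. irreducible_subshift A C"
    and "finite Q" "partition_on N Q" "\<forall>C\<in>Q. irreducible_subshift A C"
  shows "P = Q"
proof -
  have "P \<subseteq> Q" if P: "finite P" "partition_on N P" "\<forall>C\<in>P. irreducible_subshift A C"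
    and Q: "finite Q" "partition_on N Q" "\<forall>C\<in>Q. irreducible_subshift A C" for P Q
  proof
    fix C assume C: "C \<in> P"
    have sub: "\<exists>S\<in>Q. C \<subseteq> S" if "finite Q" "partition_on N Q" "\<forall>C\<in>Q. irreducible_subshift A C"
      "irreducible_subshift A C" "C \<subseteq> N" for C Q
    proof (rule irreducible_subset_part)
      show "\<forall>S\<in>Q. subshift A S" using that(3) irreducible_subshiftD(1) by blast
    qed (use that in \<open>auto simp: partition_on_def\<close>)
    have "C \<subseteq> N" using P(2) C by (auto simp: partition_on_def)
    then obtain S where S: "S \<in> Q" "C \<subseteq> S" using sub[OF Q, of C] C P(3) by blast
    have "S \<subseteq> N" using Q(2) S by (auto simp: partition_on_def)
    then obtain C' where C': "C' \<in> P" "S \<subseteq> C'" using sub[OF P, of S] S Q(3) by blast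
    have "C \<noteq> {}" using P(2) C by (auto simp: partition_on_def)
    moreover have "disjoint P" using P(2) by (simp add: partition_on_def)
    ultimately have "C = C'" using disjointD[of P C C'] C C' S by blast
    then show "C \<in> Q" using S C' by auto
  qed
  from this[OF assms] this[OF assms(4-6) assms(1-3)] show ?thesis by (rule equalityI)
qed

section \<open>Infinite components and ambiguity\<close>

context window_subshift
begin

lemma irreducible_components_eq: "irreducible_components A X = {comp w | w. reach w w}"
  unfolding irreducible_components_def
proof (rule the_equality)
  fix P assume "finite P \<and> partition_on (NW A X) P \<and> (\<forall>C\<in>P. irreducible_subshift A C)"
  then show "P = {comp w | w. reach w w}"
    using irreducible_partition_unique[of P "NW A X" A] partition_comps by blast
qed (use partition_comps in blast)

text \<open>Two points of an infinite component share the window at \<open>0\<close>. Closing both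
  up on an interval that contains \<open>0\<close> and a coordinate where they differ gives two
  distinct periodic points with a common window.\<close>

lemma infinite_comp_ambiguous:
  assumes "infinite (comp w)"
  shows ambiguous
proof -
  have "\<not> inj_on (\<lambda>x. W x 0) (comp w)"
  proof
    assume "inj_on (\<lambda>x. W x 0) (comp w)"
    moreover have "(\<lambda>x. W x 0) ` comp w \<subseteq> words" using W_in_words by (auto simp: comp_def)
    ultimately show False using assms finite_words by (meson finite_imageD finite_subset)
  qed
  then obtain x y where xy: "x \<in> comp w" "y \<in> comp w" "x \<noteq> y" "W x 0 = W y 0"
    unfolding inj_on_def by blast
  then obtain j where j: "x j \<noteq> y j" by blast
  define a b where "a = min 0 j" "b = max 0 j"
  have X: "x \<in> X" "y \<in> X" using xy by (auto simp: comp_def)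
  have ab: "a \<le> b" "a \<le> 0" "0 \<le> b" "a \<le> j" "j < b + int n" using n_pos by (auto simp: a_b_def)
  obtain p S where p: "p \<in> X" "0 < S" "periodic S p" "\<And>k. a \<le> k \<Longrightarrow> k < b + int n \<Longrightarrow> p k = x k"
    using close_up[OF X(1) ab(1)] in_comp_reach[OF xy(1)] by metis
  obtain q T where q: "q \<in> X" "0 < T" "periodic T q" "\<And>k. a \<le> k \<Longrightarrow> k < b + int n \<Longrightarrow> q k = y k"
    using close_up[OF X(2) ab(1)] in_comp_reach[OF xy(2)] by metis
  have "W p 0 = W x 0" "W q 0 = W y 0" using p(4) q(4) ab by (auto intro!: W_eqI)
  moreover have "p j \<noteq> q j" using p(4) q(4) ab j by simp
  ultimately show ?thesis using ambiguousI[OF p(1) q(1) p(2,3) q(2,3), of 0] xy(4) by auto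
qed

text \<open>The point that follows \<open>p\<close> on the left and \<open>q\<close> on the right
  lies in the component. If the component were finite, this point would be periodic, and comparing
  its two ends modulo a common period would give \<open>p = q\<close>.\<close>

lemma ambiguous_infinite_comp:
  assumes ambiguous
  shows "\<exists>w. reach w w \<and> infinite (comp w)"
proof -
  obtain p q T where pq: "p \<in> X" "q \<in> X" "0 < T" "periodic T p" "periodic T q" "p \<noteq> q" "W p 0 = W q 0"
    using assms unfolding ambiguous_def by blast
  define w where "w = W p 0"
  define z where "z = splice_at 0 p q"
  have zX: "z \<in> X" unfolding z_def using pq by (intro splice_X)
  have "reach w w" using periodic_reach[OF pq(1,3,4)] by (simp add: w_def)
  moreover have "infinite (comp w)"
  proof
    assume fin: "finite (comp w)"
    have z: "z \<in> comp w"
    proof (rule compI[OF zX])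
      fix i
      show "\<exists>j<i. reach w (W z j)"
        using W_splice_left[OF pq(7), of "min (i - 1) 0"] periodic_reach[OF pq(1,3,4)]
        by (intro exI[of _ "min (i - 1) 0"]) (simp add: z_def w_def)
      show "\<exists>j>i. reach (W z j) w"
        using W_splice_right[of 0 "max (i + 1) 0" p q] periodic_reach[OF pq(2,3,5)]
        by (intro exI[of _ "max (i + 1) 0"]) (simp add: z_def w_def pq(7))
    qed
    have "\<not> inj (\<lambda>k. translate k z)"
      using fin translate_comp[OF z] infinite_UNIV_int
      by (meson finite_imageD finite_subset image_subsetI)
    then obtain k l where kl: "k < l" "translate k z = translate l z"
      unfolding inj_def by (metis linorder_neqE)
    have "periodic (l - k) z"
      unfolding periodic_def
    proof
      fix i
      show "z (i + (l - k)) = z i" using fun_cong[OF kl(2), of "i - k"] by (simp add: algebra_simps)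
    qed
    then obtain U where U: "0 < U" "periodic U z" "periodic U p" "periodic U q"
      using kl(1) pq periodic_times[of "l - k" z T] periodic_times[of T p "l - k"]
        periodic_times[of T q "l - k"]
      by (metis diff_gt_0_iff_gt mult.commute mult_pos_pos)
    have "p i = q i" for i
    proof -
      \<comment> \<open>\<open>N\<close> is so large that \<open>i - U * N\<close> lies in the part
        taken from \<open>p\<close> and \<open>i + U * N\<close> in the part taken from
        \<open>q\<close>.\<close>
      define N where "N = \<bar>i\<bar> + 1"
      have "1 * N \<le> U * N" using U(1) by (intro mult_right_mono) (auto simp: N_def)
      moreover have "\<bar>i\<bar> < N" by (simp add: N_def)
      moreover have "U * (- N) = - (U * N)" by simp
      ultimately have N: "i + U * (- N) < 0" "0 \<le> i + U * N" by linarith+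
      then have "z (i + U * (- N)) = p (i + U * (- N))" "z (i + U * N) = q (i + U * N)"
        by (simp_all add: z_def splice_at_def)
      then show ?thesis
        using periodic_mult[OF U(2)] periodic_mult[OF U(3)] periodic_mult[OF U(4)] by metis
    qed
    then show False using pq(6) by blast
  qed
  ultimately show ?thesis by blast
qed

subsection \<open>The order on the components\<close>

text \<open>Serves both limit sets: components are disjoint, so one point of a limit set already
  determines the component containing it.\<close>

lemma comp_the_unique:
  assumes "reach w w" "p \<in> L" "L \<subseteq> comp w"
  shows "(THE C. C \<in> irreducible_components A X \<and> L \<subseteq> C) = comp w"
proof (rule the_equality)
  fix C assume "C \<in> irreducible_components A X \<and> L \<subseteq> C"
  then obtain v where "C = comp v" "p \<in> comp v" using assms(2) irreducible_components_eq by blast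
  then show "C = comp w" using in_comp_eq(2)[of p v w] assms by blast
qed (use assms irreducible_components_eq in blast)

lemma limit_in_comp:
  assumes "x \<in> X" and "\<And>i. \<exists>j. W y i = W x j \<and> reach (W x j) w \<and> reach w (W x j)"
  shows "y \<in> comp w"
proof -
  have "y \<in> X"
  proof (rule window_X)
    fix i
    obtain j where "W y i = W x j" using assms(2) by blast
    then have "W y i = W (translate (j - i) x) i" by simp
    then show "\<exists>z\<in>X. \<forall>k. i \<le> k \<and> k < i + int n \<longrightarrow> y k = z k"
      using W_eqD translate_X[OF assms(1)] by blast
  qed
  moreover have "reach (W y i) w \<and> reach w (W y i)" for i using assms(2)[of i] by auto
  ultimately show ?thesis by (simp add: comp_def)
qed

text \<open>Without ambiguity \<open>x\<close> coincides with a periodic point \<open>p\<close> from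
  \<open>b\<close> on, so its shifts by multiples of the period converge to \<open>p\<close>, and
  the limit set is nonempty. The windows of any limit point occur in \<open>x\<close> beyond
  \<open>b\<close>, hence belong to the same class.\<close>

lemma C_omega_eq:
  assumes "\<not> ambiguous" and x: "x \<in> X"
    and b: "\<And>i j. b \<le> i \<Longrightarrow> b \<le> j \<Longrightarrow> reach (W x i) (W x j)"
  shows "C_omega A X x = comp (W x b)"
proof -
  have rec: "reach (W x b) (W x b)" using b by simp
  obtain p T where p: "p \<in> X" "0 < T" "periodic T p" "W p b = W x b"
    using recurrent_periodic[OF rec] by metis
  have xp: "x k = p k" if "b \<le> k" for k
    using interval_eq_periodic[OF assms(1) x that _ p(1-3) order_refl that p(4) that] b that n_pos by simp
  have "p \<in> omega_limit A x"
    unfolding omega_limit_def mem_Collect_eq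
  proof (intro exI conjI)
    show "strict_mono (\<lambda>k. k * nat T)" using p(2) by (simp add: strict_mono_def)
    show "limitin (shift_topology A) (\<lambda>k. (shift ^^ (k * nat T)) x) p sequentially"
    proof (rule limitin_shift_topologyI)
      fix m
      have "agree m p ((shift ^^ (k * nat T)) x)" if k: "k \<ge> m + nat \<bar>b\<bar>" for k
        unfolding agree_def shift_funpow translate_apply
      proof (intro allI impI)
        fix i assume i: "\<bar>i\<bar> \<le> int m"
        have "int k * 1 \<le> int k * T" using p(2) by (intro mult_left_mono) auto
        moreover have "- int k + b \<le> i" using i k by linarith
        ultimately have "b \<le> i + T * int k" by (simp add: mult.commute)
        then show "p i = x (i + int (k * nat T))"
          using xp periodic_mult[OF p(3), of i "int k"] p(2) by (simp add: mult.commute)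
      qed
      then show "\<exists>k0. \<forall>k\<ge>k0. agree m p ((shift ^^ (k * nat T)) x)" by blast
    qed (use X_A p x in \<open>auto simp: shift_funpow\<close>)
  qed
  moreover have "omega_limit A x \<subseteq> comp (W x b)"
  proof
    fix y assume "y \<in> omega_limit A x"
    then obtain f :: "nat \<Rightarrow> nat" where f: "strict_mono f"
      "limitin (shift_topology A) (\<lambda>k. (shift ^^ f k) x) y sequentially"
      unfolding omega_limit_def by blast
    show "y \<in> comp (W x b)"
    proof (rule limit_in_comp[OF x])
      fix i
      obtain k0 where k0: "\<forall>k\<ge>k0. agree (nat \<bar>i\<bar> + n) y ((shift ^^ f k) x)"
        using limitin_shift_topology[OF f(2)] by metis
      define k where "k = k0 + nat \<bar>b - i\<bar>"
      have "agree (nat \<bar>i\<bar> + n) y ((shift ^^ f k) x)" using k0 by (simp add: k_def)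
      then have "W y i = W (translate (int (f k)) x) i"
        by (intro W_eqI) (auto simp: agree_def shift_funpow)
      moreover have "b \<le> i + int (f k)"
        using strict_mono_imp_increasing[OF f(1), of k] by (simp add: k_def)
      ultimately show "\<exists>j. W y i = W x j \<and> reach (W x j) (W x b) \<and> reach (W x b) (W x j)"
        using b by (intro exI[of _ "i + int (f k)"]) simp
    qed
  qed
  ultimately show ?thesis unfolding C_omega_def by (rule comp_the_unique[OF rec])
qed

lemma C_alpha_eq:
  assumes "\<not> ambiguous" and x: "x \<in> X"
    and b: "\<And>i j. i \<le> b \<Longrightarrow> j \<le> b \<Longrightarrow> reach (W x i) (W x j)"
  shows "C_alpha A X x = comp (W x b)"
proof -
  have rec: "reach (W x b) (W x b)" using b by simp
  obtain p T where p: "p \<in> X" "0 < T" "periodic T p" "W p b = W x b"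
    using recurrent_periodic[OF rec] by metis
  have xp: "x k = p k" if "k \<le> b" for k
    using interval_eq_periodic[OF assms(1) x that _ p(1-3) that order_refl p(4) order_refl] b that n_pos by simp
  have "p \<in> alpha_limit A x"
    unfolding alpha_limit_def mem_Collect_eq
  proof (intro exI conjI)
    show "strict_mono (\<lambda>k. k * nat T)" using p(2) by (simp add: strict_mono_def)
    show "limitin (shift_topology A) (\<lambda>k. (inv shift ^^ (k * nat T)) x) p sequentially"
    proof (rule limitin_shift_topologyI)
      fix m
      have "agree m p ((inv shift ^^ (k * nat T)) x)" if k: "k \<ge> m + nat \<bar>b\<bar>" for k
        unfolding agree_def inv_shift_funpow translate_apply
      proof (intro allI impI)
        fix i assume i: "\<bar>i\<bar> \<le> int m"
        have "int k * 1 \<le> int k * T" using p(2) by (intro mult_left_mono) auto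
        moreover have "i \<le> int k + b" using i k by linarith
        ultimately have "i + T * (- int k) \<le> b" by (simp add: mult.commute)
        then show "p i = x (i + - int (k * nat T))"
          using xp periodic_mult[OF p(3), of i "- int k"] p(2) by (simp add: mult.commute)
      qed
      then show "\<exists>k0. \<forall>k\<ge>k0. agree m p ((inv shift ^^ (k * nat T)) x)" by blast
    qed (use X_A p x in \<open>auto simp: inv_shift_funpow\<close>)
  qed
  moreover have "alpha_limit A x \<subseteq> comp (W x b)"
  proof
    fix y assume "y \<in> alpha_limit A x"
    then obtain f :: "nat \<Rightarrow> nat" where f: "strict_mono f"
      "limitin (shift_topology A) (\<lambda>k. (inv shift ^^ f k) x) y sequentially"
      unfolding alpha_limit_def by blast
    show "y \<in> comp (W x b)"
    proof (rule limit_in_comp[OF x])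
      fix i
      obtain k0 where k0: "\<forall>k\<ge>k0. agree (nat \<bar>i\<bar> + n) y ((inv shift ^^ f k) x)"
        using limitin_shift_topology[OF f(2)] by metis
      define k where "k = k0 + nat \<bar>b - i\<bar>"
      have "agree (nat \<bar>i\<bar> + n) y ((inv shift ^^ f k) x)" using k0 by (simp add: k_def)
      then have "W y i = W (translate (- int (f k)) x) i"
        by (intro W_eqI) (auto simp: agree_def inv_shift_funpow)
      moreover have "i - int (f k) \<le> b"
        using strict_mono_imp_increasing[OF f(1), of k] by (simp add: k_def)
      ultimately show "\<exists>j. W y i = W x j \<and> reach (W x j) (W x b) \<and> reach (W x b) (W x j)"
        using b by (intro exI[of _ "i - int (f k)"]) simp
    qed
  qed
  ultimately show ?thesis unfolding C_alpha_def by (rule comp_the_unique[OF rec])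
qed

text \<open>A point witnessing the order leads from its left class to its right class. Conversely, a
  point leading from \<open>v\<close> to \<open>w\<close> gets periodic tails through
  \<open>v\<close> and \<open>w\<close> spliced to its two ends.\<close>

lemma component_le_iff:
  assumes amb: "\<not> ambiguous" and v: "reach v v" and w: "reach w w"
  shows "component_le A X (comp v) (comp w) \<longleftrightarrow> reach v w"
proof
  assume "component_le A X (comp v) (comp w)"
  then obtain x where x: "x \<in> X" "C_alpha A X x = comp v" "C_omega A X x = comp w"
    unfolding component_le_def by blast
  obtain a where a: "\<And>i j. i \<le> a \<Longrightarrow> j \<le> a \<Longrightarrow> reach (W x i) (W x j)"
    using eventual_class_left[OF x(1)] by metis
  obtain b0 where b0: "\<And>i j. b0 \<le> i \<Longrightarrow> b0 \<le> j \<Longrightarrow> reach (W x i) (W x j)"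
    using eventual_class_right[OF x(1)] by metis
  \<comment> \<open>Taking \<open>b\<close> to the right of \<open>a\<close> lets \<open>x\<close>
    itself witness that the left class reaches the right one.\<close>
  define b where "b = max b0 (a + 1)"
  have b: "reach (W x i) (W x j)" if "b \<le> i" "b \<le> j" for i j using b0 that by (simp add: b_def)
  have "comp v = comp (W x a)" "comp w = comp (W x b)"
    using C_alpha_eq[OF amb x(1) a] C_omega_eq[OF amb x(1) b] x(2,3) by auto
  then have "reach v (W x a)" "reach (W x b) w"
    using comp_eq_iff[of v "W x a"] comp_eq_iff[of w "W x b"] v w a b by auto
  moreover have "reach (W x a) (W x b)" using reachI[OF x(1)] by (simp add: b_def)
  ultimately show "reach v w" using reach_trans by blast
next
  assume "reach v w"
  then obtain x i j where x: "x \<in> X" "i < j" "W x i = v" "W x j = w"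
    unfolding reach_def by blast
  obtain p S where p: "p \<in> X" "0 < S" "periodic S p" "W p i = v" using recurrent_periodic[OF v] by metis
  obtain q T where q: "q \<in> X" "0 < T" "periodic T q" "W q j = w" using recurrent_periodic[OF w] by metis
  define y where "y = splice_at i p x"
  define z where "z = splice_at j y q"
  have pi: "W p i = W x i" using p(4) x(3) by simp
  have y: "y \<in> X" "W y j = w" using splice_X[OF p(1) x(1) pi] W_splice_right[of i j p x] x by (simp_all add: y_def)
  have yj: "W y j = W q j" using y(2) q(4) by simp
  have z: "z \<in> X" using splice_X[OF y(1) q(1) yj] by (simp add: z_def)
  have l: "W z k = W p k" if "k \<le> i" for k
    using that x(2) W_splice_left[OF yj, of k] W_splice_left[OF pi, of k] by (simp add: z_def y_def)
  have r: "W z k = W q k" if "j \<le> k" for k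
    using that W_splice_right[of j k y q] by (simp add: z_def)
  have "C_alpha A X z = comp (W z i)"
    using l periodic_reach[OF p(1-3)] by (intro C_alpha_eq[OF amb z]) simp
  moreover have "C_omega A X z = comp (W z j)"
    using r periodic_reach[OF q(1-3)] by (intro C_omega_eq[OF amb z]) simp
  ultimately show "component_le A X (comp v) (comp w)"
    unfolding component_le_def using z l[of i] r[of j] p(4) q(4) by auto
qed

definition two_layered :: bool where
  "two_layered \<longleftrightarrow> (\<forall>w. reach w w \<longrightarrow>
     (\<forall>v. reach v v \<and> reach v w \<longrightarrow> reach w v) \<or> (\<forall>v. reach v v \<and> reach w v \<longrightarrow> reach v w))"

lemma finite_extremal_iff:
  "(\<forall>C\<in>irreducible_components A X.
      finite C \<and> extremal_in (irreducible_components A X) (component_le A X) C) \<longleftrightarrow>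
   \<not> ambiguous \<and> two_layered"
proof (cases ambiguous)
  case True
  then show ?thesis using ambiguous_infinite_comp irreducible_components_eq by blast
next
  case False
  have fin: "finite (comp w)" for w using infinite_comp_ambiguous False by blast
  have ext: "extremal_in (irreducible_components A X) (component_le A X) (comp w) \<longleftrightarrow>
      (\<forall>v. reach v v \<and> reach v w \<longrightarrow> reach w v) \<or> (\<forall>v. reach v v \<and> reach w v \<longrightarrow> reach v w)"
    if w: "reach w w" for w
  proof -
    have "(\<forall>d\<in>{comp w |w. reach w w}. component_le A X d (comp w) \<longrightarrow> d = comp w) \<longleftrightarrow>
        (\<forall>v. reach v v \<and> reach v w \<longrightarrow> reach w v)"
      using component_le_iff[OF False _ w] comp_eq_iff[OF _ w] by blast
    moreover have "(\<forall>d\<in>{comp w |w. reach w w}. component_le A X (comp w) d \<longrightarrow> d = comp w) \<longleftrightarrow>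
        (\<forall>v. reach v v \<and> reach w v \<longrightarrow> reach v w)"
      using component_le_iff[OF False w] comp_eq_iff[OF _ w] by blast
    moreover have "comp w \<in> {comp w |w. reach w w}" using w by blast
    ultimately show ?thesis unfolding extremal_in_def irreducible_components_eq by simp
  qed
  have "(\<forall>C\<in>{comp w |w. reach w w}.
      finite C \<and> extremal_in (irreducible_components A X) (component_le A X) C) \<longleftrightarrow>
      (\<forall>w. reach w w \<longrightarrow> extremal_in (irreducible_components A X) (component_le A X) (comp w))"
    using fin by blast
  then show ?thesis
    using False ext unfolding two_layered_def irreducible_components_eq by simp
qed

end

section \<open>Surjective endomorphisms of systems with finitely many orbits\<close>

lemma endomorphism_translate:
  assumes "endomorphism A X \<tau>" "x \<in> X" and X: "\<And>x k. x \<in> X \<Longrightarrow> translate k x \<in> X"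
  shows "\<tau> (translate k x) = translate k (\<tau> x)"
proof -
  have nat: "\<tau> (translate (int m) x) = translate (int m) (\<tau> x)" if "x \<in> X" for m x
  proof (induction m)
    case (Suc m)
    have "\<tau> (shift (translate (int m) x)) = shift (\<tau> (translate (int m) x))"
      using assms(1) X[OF that] unfolding endomorphism_def by blast
    then show ?case using Suc by (simp add: shift_eq_translate del: translate_apply)
  qed simp
  show ?thesis
  proof (cases "k \<ge> 0")
    case True
    then show ?thesis using nat[OF assms(2), of "nat k"] by simp
  next
    case False
    then have "\<tau> x = translate (- k) (\<tau> (translate k x))"
      using nat[OF X[OF assms(2), of k], of "nat (- k)"] by simp
    then show ?thesis by simp
  qed
qed

text \<open>A surjective endomorphism permutes the finitely many orbits, and it also permutes the
  finitely many periodic points. Two points with equal images lie in one orbit; if they differ, the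
  image is periodic, hence so are they, and on periodic points the map is injective.\<close>

lemma injunctive_if_finitely_many_orbits:
  fixes X :: "(int \<Rightarrow> 'a) set"
  assumes X: "\<And>x k. x \<in> X \<Longrightarrow> translate k x \<in> X"
    and P: "finite {x \<in> X. \<exists>T>0. periodic T x}"
    and F: "finite F" "\<And>x. x \<in> X \<Longrightarrow> \<exists>k. translate k x \<in> F"
  shows "injunctive A X"
  unfolding injunctive_def
proof (intro allI impI)
  fix \<tau> assume tau: "endomorphism A X \<tau> \<and> \<tau> ` X = X"
  define Per where "Per = {x \<in> X. \<exists>T>0. periodic T x}"
  define orb where "orb x = range (\<lambda>k. translate k x)" for x :: "int \<Rightarrow> 'a"
  have eq: "\<tau> (translate k x) = translate k (\<tau> x)" if "x \<in> X" for k x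
    using endomorphism_translate[of A X \<tau> x k] tau that X by blast
  have orb_tau: "\<tau> ` orb x = orb (\<tau> x)" if "x \<in> X" for x
    using eq[OF that] by (auto simp: orb_def image_image)
  have orb_translate: "orb (translate k x) = orb x" for k x
  proof -
    have "translate l x \<in> orb (translate k x)" for l
      unfolding orb_def by (rule image_eqI[of _ _ "l - k"]) simp_all
    moreover have "translate l (translate k x) \<in> orb x" for l
      unfolding orb_def by (rule image_eqI[of _ _ "l + k"]) simp_all
    ultimately show ?thesis by (auto simp: orb_def simp del: translate_translate)
  qed
  have "orb ` X \<subseteq> orb ` F" using F(2) orb_translate by blast
  then have fin: "finite (orb ` X)" using F(1) finite_subset by blast
  have "orb ` X \<subseteq> (\<lambda>S. \<tau> ` S) ` orb ` X"
  proof
    fix S assume "S \<in> orb ` X"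
    then obtain y where "y \<in> X" "S = orb y" by blast
    moreover then obtain x where "x \<in> X" "y = \<tau> x" using tau by blast
    ultimately show "S \<in> (\<lambda>S. \<tau> ` S) ` orb ` X" using orb_tau by blast
  qed
  then have inj: "inj_on (\<lambda>S. \<tau> ` S) (orb ` X)" using fin finite_surj_inj by blast
  have same: "orb x = orb y" if "x \<in> X" "y \<in> X" "orb (\<tau> x) = orb (\<tau> y)" for x y
    using inj_onD[OF inj, of "orb x" "orb y"] that orb_tau by simp
  have Per_tau: "\<tau> x \<in> Per" if xP: "x \<in> Per" for x
  proof -
    have x: "x \<in> X" using xP by (simp add: Per_def)
    obtain T where T: "0 < T" "periodic T x" using xP by (auto simp: Per_def)
    then have "translate T x = x" by (simp add: periodic_def fun_eq_iff)
    then have "translate T (\<tau> x) = \<tau> x" using eq[OF x, of T] by simp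
    then have "periodic T (\<tau> x)" by (simp add: periodic_def fun_eq_iff)
    then show ?thesis using T(1) x tau unfolding Per_def by blast
  qed
  have Per_orb: "y \<in> Per" if "x \<in> Per" "y \<in> orb x" for x y
    using that X periodic_translate unfolding Per_def orb_def by blast
  have self: "x \<in> orb x" for x :: "int \<Rightarrow> 'a" unfolding orb_def by (rule image_eqI[of _ _ 0]) auto
  have Per_X: "Per \<subseteq> X" by (auto simp: Per_def)
  have "inj_on (\<lambda>S. \<tau> ` S) (orb ` Per)" using inj Per_X by (meson image_mono inj_on_subset)
  moreover have "(\<lambda>S. \<tau> ` S) ` orb ` Per \<subseteq> orb ` Per" using orb_tau Per_tau Per_X by auto
  \<comment> \<open>An injective self-map of the finite set of periodic orbits is onto; so no orbit
    of nonperiodic points can be mapped to a periodic orbit.\<close>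
  ultimately have surjP: "(\<lambda>S. \<tau> ` S) ` orb ` Per = orb ` Per"
    using P unfolding Per_def[symmetric] by (intro endo_inj_surj) auto
  have Per_back: "x \<in> Per" if x: "x \<in> X" "\<tau> x \<in> Per" for x
  proof -
    obtain z where z: "z \<in> Per" "orb (\<tau> x) = \<tau> ` orb z" using surjP x(2) by blast
    then have "orb x = orb z" using same[OF x(1), of z] orb_tau[of z] Per_X by auto
    then show ?thesis using Per_orb[OF z(1)] self by blast
  qed
  have "Per \<subseteq> \<tau> ` Per"
  proof
    fix y assume y: "y \<in> Per"
    then obtain x where x: "x \<in> X" "y = \<tau> x" using tau Per_X by (metis imageE subsetD)
    then show "y \<in> \<tau> ` Per" using Per_back[OF x(1)] y by simp
  qed
  with P[folded Per_def] have injP: "inj_on \<tau> Per" by (rule finite_surj_inj)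
  show "inj_on \<tau> X"
  proof
    fix x y assume xy: "x \<in> X" "y \<in> X" "\<tau> x = \<tau> y"
    have "orb x = orb y" by (rule same[OF xy(1,2)]) (simp only: xy(3))
    then obtain k where k: "y = translate k x" using self[of y] unfolding orb_def by (metis imageE)
    show "x = y"
    proof (cases "k = 0")
      case False
      have "translate k (\<tau> x) = \<tau> x" using eq[OF xy(1), of k] xy(3) k by simp
      then have "periodic k (\<tau> x)" by (simp add: periodic_def fun_eq_iff)
      then have "periodic (k * k) (\<tau> x)" by (rule periodic_times)
      \<comment> \<open>\<open>k\<close> may be negative, but its square is a positive
        period.\<close>
      moreover have "0 < k * k" using False by (simp add: zero_less_mult_iff) linarith
      ultimately have "\<tau> x \<in> Per" using tau xy(1) unfolding Per_def by blast
      then have "x \<in> Per" "y \<in> Per" using Per_back[OF xy(1)] Per_back[OF xy(2)] xy(3) by simp_all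
      then show ?thesis using injP xy(3) by (simp add: inj_on_def)
    qed (use k in simp)
  qed
qed

context window_subshift
begin

subsection \<open>Two layers of periodic orbits\<close>

text \<open>Left of \<open>k\<close> there is a recurrent window. It reaches the window at
  \<open>i\<close>, so by minimality it is reached from there, and from it \<open>z\<close> leads on
  to the window at \<open>k\<close>.\<close>

lemma minimal_reaches_left:
  assumes "\<And>u. reach u u \<Longrightarrow> reach u (W z i) \<Longrightarrow> reach (W z i) u" and z: "z \<in> X" and "k \<le> i"
  shows "reach (W z i) (W z k)"
proof -
  \<comment> \<open>Starting \<open>card words + 2\<close> positions before \<open>k\<close> makes
    the pigeonhole interval end at \<open>k - 1\<close>.\<close>
  obtain j where "j \<le> k - 1" "reach (W z j) (W z j)"
    using recurrent_window_in_interval[OF z, of "k - int (card words) - 2"] by auto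
  then show ?thesis using assms(1)[of "W z j"] reachI[OF z, of j i] reachI[OF z, of j k] assms(3)
      reach_trans[of "W z i" "W z j" "W z k"] by simp
qed

lemma maximal_reached_right:
  assumes "\<And>u. reach u u \<Longrightarrow> reach (W z i) u \<Longrightarrow> reach u (W z i)" and z: "z \<in> X" and "i \<le> k"
  shows "reach (W z k) (W z i)"
proof -
  obtain j where "k < j" "reach (W z j) (W z j)"
    using recurrent_window_in_interval[OF z, of k] by auto
  then show ?thesis using assms(1)[of "W z j"] reachI[OF z, of i j] reachI[OF z, of k j] assms(3)
      reach_trans[of "W z k" "W z j" "W z i"] by simp
qed

text \<open>Soon after leaving its class at \<open>i\<close>, the point meets a recurrent window at
  some \<open>j\<close> in a strictly higher class. With two layers the first class is minimal and
  the second maximal, so the point follows a fixed periodic point up to \<open>i\<close> and another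
  one from \<open>j\<close> on. The prescribed stretch is long enough to contain the whole window at
  \<open>j\<close>.\<close>

lemma exit_determines:
  assumes amb: "\<not> ambiguous" and lay: two_layered and x: "x \<in> X" and y: "y \<in> X"
    and rec: "reach (W x i) (W x i)" and exit: "\<not> reach (W x (i + 1)) (W x i)"
    and eq: "\<And>k. i \<le> k \<Longrightarrow> k < i + int (card words + 2 + n) \<Longrightarrow> x k = y k"
  shows "x = y"
proof -
  obtain j where j: "i < j" "j \<le> i + int (card words) + 1" "reach (W x j) (W x j)"
    using recurrent_window_in_interval[OF x] by metis
  have ij: "reach (W x i) (W x j)" using reachI[OF x j(1)] .
  have ji: "\<not> reach (W x j) (W x i)"
    using exit reachI[OF x, of "i + 1" j] j(1) reach_trans[of "W x (i + 1)"] by (cases "j = i + 1") auto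
  have min: "reach (W x i) u" if "reach u u" "reach u (W x i)" for u
    using lay rec j(3) ij ji that unfolding two_layered_def by blast
  have max: "reach u (W x j)" if "reach u u" "reach (W x j) u" for u
    using lay rec j(3) ij ji that unfolding two_layered_def by blast
  have Wi: "W y i = W x i" and Wj: "W y j = W x j" using eq j by (auto intro!: W_eqI)
  obtain p S where p: "p \<in> X" "0 < S" "periodic S p" "W p i = W x i"
    using recurrent_periodic[OF rec] by metis
  obtain q T where q: "q \<in> X" "0 < T" "periodic T q" "W q j = W x j"
    using recurrent_periodic[OF j(3)] by metis
  have left: "z k = p k" if z: "z \<in> X" "W z i = W x i" and k: "k \<le> i" for z k
    by (rule interval_eq_periodic[OF amb z(1) k _ p(1-3) k order_refl])
      (use minimal_reaches_left[of z i] z k min p(4) n_pos in auto)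
  have right: "z k = q k" if z: "z \<in> X" "W z j = W x j" and k: "j \<le> k" for z k
    by (rule interval_eq_periodic[OF amb z(1) k _ q(1-3) order_refl k])
      (use maximal_reached_right[of z j] z k max q(4) n_pos in auto)
  show ?thesis
  proof
    fix k
    consider "k \<le> i" | "j \<le> k" | "i \<le> k" "k < j" by linarith
    then show "x k = y k"
    proof cases
      case 1
      then show ?thesis using left[OF x] left[OF y Wi] by simp
    next
      case 2
      then show ?thesis using right[OF x] right[OF y Wj] by simp
    next
      case 3
      then show ?thesis using eq j by simp
    qed
  qed
qed

text \<open>Recurrent windows exist arbitrarily far to the left and their class is never left, so
  all windows lie in one class and \<open>interval_eq_periodic\<close> applies to every
  interval.\<close>

lemma no_exit_periodic:
  assumes amb: "\<not> ambiguous" and x: "x \<in> X"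
    and noexit: "\<And>i. reach (W x i) (W x i) \<Longrightarrow> reach (W x (i + 1)) (W x i)"
  shows "\<exists>T>0. periodic T x"
proof -
  have ret: "reach (W x j) (W x i)" if rec: "reach (W x i) (W x i)" and "i \<le> j" for i j
    using \<open>i \<le> j\<close>
  proof (induction j rule: int_ge_induct)
    case (step j)
    have "reach (W x i) (W x j)"
      using rec reachI[OF x, of i j] step.hyps by (cases "i = j") simp_all
    then have "reach (W x j) (W x j)" using step.IH reach_trans[of "W x j" "W x i"] by simp
    then show ?case using noexit step.IH reach_trans[of "W x (j + 1)" "W x j"] by simp
  qed (use rec in simp)
  have rec: "reach (W x k) (W x k)" for k
  proof -
    obtain j where "j \<le> k - 1" "reach (W x j) (W x j)"
      using recurrent_window_in_interval[OF x, of "k - int (card words) - 2"] by auto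
    then show ?thesis using ret[of j k] reachI[OF x, of j k] reach_trans[of "W x k" "W x j"] by simp
  qed
  obtain p T where p: "p \<in> X" "0 < T" "periodic T p" "W p 0 = W x 0"
    using recurrent_periodic[OF rec] by metis
  have "x k = p k" for k
  proof (rule interval_eq_periodic[OF amb x, of "min 0 k" "max 0 k" p T 0])
    show "reach (W x (max 0 k)) (W x (min 0 k))" using ret[OF rec] by simp
  qed (use p n_pos in auto)
  then have "x = p" by blast
  then show ?thesis using p by blast
qed

lemma finite_periodic_points:
  assumes "\<not> ambiguous"
  shows "finite {x \<in> X. \<exists>T>0. periodic T x}"
proof -
  have "inj_on (\<lambda>x. W x 0) {x \<in> X. \<exists>T>0. periodic T x}"
  proof (intro inj_onI)
    fix x y assume "x \<in> {x \<in> X. \<exists>T>0. periodic T x}" "y \<in> {x \<in> X. \<exists>T>0. periodic T x}" "W x 0 = W y 0"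
    moreover then obtain S T where "0 < S" "periodic S x" "0 < T" "periodic T y" by blast
    ultimately show "x = y" using ambiguousI[of x y S T 0] assms by blast
  qed
  moreover have "(\<lambda>x. W x 0) ` {x \<in> X. \<exists>T>0. periodic T x} \<subseteq> words" using W_in_words by auto
  ultimately show ?thesis using finite_words by (meson finite_imageD finite_subset)
qed

text \<open>Normalised representatives of the nonperiodic orbits: the point leaves the class of a
  recurrent window exactly at position \<open>0\<close>.\<close>

definition exits :: "(int \<Rightarrow> 'a) set" where
  "exits = {x \<in> X. reach (W x 0) (W x 0) \<and> \<not> reach (W x 1) (W x 0)}"

lemma finite_exits:
  assumes "\<not> ambiguous" two_layered
  shows "finite exits"
proof -
  define N where "N = card words + 2 + n"
  let ?f = "\<lambda>x. map (\<lambda>k. x (int k)) [0..<N]"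
  have "inj_on ?f exits"
  proof
    fix x y assume xy: "x \<in> exits" "y \<in> exits" "?f x = ?f y"
    have "x k = y k" if "0 \<le> k" "k < int N" for k
    proof -
      have "\<forall>m<N. x (int m) = y (int m)" using xy(3) by auto
      moreover have "nat k < N" using that by linarith
      ultimately show ?thesis using that(1) by (metis int_nat_eq)
    qed
    then show "x = y" using exit_determines[OF assms, of x y 0] xy(1,2) by (auto simp: exits_def N_def)
  qed
  moreover have "?f ` exits \<subseteq> {w. set w \<subseteq> A \<and> length w = N}" using X_A by (auto simp: exits_def)
  ultimately show ?thesis using finite_lists_length_eq[OF finite_A] by (meson finite_imageD finite_subset)
qed

lemma periodic_or_exits:
  assumes "\<not> ambiguous" "x \<in> X"
  shows "(\<exists>T>0. periodic T x) \<or> (\<exists>i. translate i x \<in> exits)"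
proof (cases "\<exists>i. reach (W x i) (W x i) \<and> \<not> reach (W x (i + 1)) (W x i)")
  case True
  then obtain i where "reach (W x i) (W x i)" "\<not> reach (W x (i + 1)) (W x i)" by blast
  then have "translate i x \<in> exits" using translate_X[OF assms(2)] by (simp add: exits_def add.commute)
  then show ?thesis by blast
next
  case False
  then show ?thesis using no_exit_periodic[OF assms] by blast
qed

lemma two_layered_injunctive:
  assumes "\<not> ambiguous" two_layered
  shows "injunctive A X"
proof (rule injunctive_if_finitely_many_orbits)
  show "finite ({x \<in> X. \<exists>T>0. periodic T x} \<union> exits)"
    using finite_periodic_points finite_exits assms by simp
  fix x assume "x \<in> X"
  then show "\<exists>k. translate k x \<in> {x \<in> X. \<exists>T>0. periodic T x} \<union> exits"
    using periodic_or_exits[OF assms(1), of x] by (metis (mono_tags, lifting) UnCI mem_Collect_eq translate_0)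
qed (rule translate_X, assumption, rule finite_periodic_points[OF assms(1)])

lemma two_layered_countable:
  assumes "\<not> ambiguous" two_layered
  shows "countable X"
proof (rule countable_subset)
  show "X \<subseteq> {x \<in> X. \<exists>T>0. periodic T x} \<union> (\<Union>i. translate i ` exits)"
  proof
    fix x assume x: "x \<in> X"
    have "x \<in> translate (- i) ` exits" if "translate i x \<in> exits" for i
      using that by (intro image_eqI[of _ _ "translate i x"]) auto
    then show "x \<in> {x \<in> X. \<exists>T>0. periodic T x} \<union> (\<Union>i. translate i ` exits)"
      using periodic_or_exits[OF assms(1) x] x by blast
  qed
  show "countable ({x \<in> X. \<exists>T>0. periodic T x} \<union> (\<Union>i. translate i ` exits))"
    using finite_periodic_points finite_exits assms by (auto intro: countable_finite)
qed

lemma t1_X: "t1_space (subtopology (shift_topology A) X)"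
  by (simp add: Hausdorff_imp_t1_space Hausdorff_shift_topology Hausdorff_space_subtopology)

text \<open>A translate of a nonperiodic point is in \<open>exits\<close>, so by
  \<open>exit_determines\<close> finitely many coordinates single it out and it is isolated.\<close>

lemma two_layered_derived:
  assumes "\<not> ambiguous" two_layered
  shows "subtopology (shift_topology A) X derived_set_of X \<subseteq> {x \<in> X. \<exists>T>0. periodic T x}"
proof
  fix x assume x: "x \<in> subtopology (shift_topology A) X derived_set_of X"
  then have xX: "x \<in> X" using in_derived_set_of_shift_iff[OF X_subset] by blast
  have "\<nexists>i. translate i x \<in> exits"
  proof
    assume "\<exists>i. translate i x \<in> exits"
    then obtain i where i: "translate i x \<in> exits" by blast
    obtain y where y: "y \<in> X" "y \<noteq> x" "agree (nat \<bar>i\<bar> + (card words + 2 + n)) x y"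
      using x in_derived_set_of_shift_iff[OF X_subset] by blast
    have "x = y"
    proof (rule exit_determines[OF assms xX y(1)])
      fix k assume "i \<le> k" "k < i + int (card words + 2 + n)"
      then have "\<bar>k\<bar> \<le> int (nat \<bar>i\<bar> + (card words + 2 + n))" by linarith
      then show "x k = y k" using y(3) unfolding agree_def by blast
    qed (use i in \<open>auto simp: exits_def add.commute\<close>)
    then show False using y(2) by simp
  qed
  then show "x \<in> {x \<in> X. \<exists>T>0. periodic T x}" using periodic_or_exits[OF assms(1) xX] xX by blast
qed

lemma two_layered_cb_rank:
  assumes "\<not> ambiguous" two_layered
  shows "cb_rank (subtopology (shift_topology A) X) \<le> osucc (osucc 0)"
proof (rule cb_rank_le_two_if_derived_empty[OF t1_X])
  let ?T = "subtopology (shift_topology A) X"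
  have "finite (?T derived_set_of X)"
    using two_layered_derived[OF assms] finite_periodic_points[OF assms(1)] finite_subset by blast
  then have "?T derived_set_of (?T derived_set_of X) = {}"
    using t1_X t1_space_derived_set_of_finite by blast
  then show "?T derived_set_of (?T derived_set_of topspace ?T) = {}"
    by (simp only: topspace_subtopology_shift[OF X_subset])
qed

subsection \<open>Three layers: the rank exceeds two\<close>

lemma closedin_X: "closedin (shift_topology A) X"
  unfolding closedin_shift_topology_iff
proof (intro conjI allI impI X_subset)
  fix x assume x: "(\<forall>i. x i \<in> A) \<and> (\<forall>m. \<exists>y\<in>X. agree m x y)"
  show "x \<in> X"
  proof (rule window_X)
    fix i
    obtain y where "y \<in> X" "agree (nat \<bar>i\<bar> + n) x y" using x by blast
    then show "\<exists>y\<in>X. \<forall>k. i \<le> k \<and> k < i + int n \<longrightarrow> x k = y k"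
      unfolding agree_def by (intro bexI[of _ y]) auto
  qed
qed

lemma not_two_layeredE:
  assumes "\<not> two_layered"
  obtains u v w where "reach w w" "reach u w" "\<not> reach w u" "reach v v" "reach w v" "\<not> reach v w"
  using assms unfolding two_layered_def by blast

text \<open>Let the periodic point \<open>p\<close> pass through the middle window \<open>w\<close>.
  A point that ends in \<open>p\<close> is a limit of points that leave \<open>p\<close> later and
  later towards \<open>v\<close>. Points that come from \<open>u\<close> and end in \<open>p\<close>
  are thus in the first derivative, and they accumulate at \<open>p\<close>.\<close>

lemma second_derived_nonempty:
  assumes "\<not> two_layered"
  defines "T \<equiv> subtopology (shift_topology A) X"
  shows "T derived_set_of (T derived_set_of X) \<noteq> {}"
proof -
  obtain u v w where w: "reach w w" and u: "reach u w" "\<not> reach w u" and v: "reach w v" "\<not> reach v w"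
    using not_two_layeredE[OF assms(1)] by metis
  obtain p S where p: "p \<in> X" "0 < S" "periodic S p" "W p 0 = w"
    using recurrent_periodic[OF w] by metis
  obtain y i where y: "y \<in> X" "i < 0" "W y i = u" "\<And>k. 0 \<le> k \<Longrightarrow> y k = p k"
    using reach_extend_left[OF u(1) p(1,4)] by metis
  obtain z j where z: "z \<in> X" "0 < j" "W z j = v" "\<And>k. k < 0 + int n \<Longrightarrow> z k = p k"
    using reach_extend_right[OF v(1) p(1,4)] by metis
  have z0: "W z 0 = w" using z(4) p(4) by (simp add: W_eqI[of 0 z p])
  have p_w: "reach (W p k) w" "reach w (W p k)" for k
    using periodic_reach[OF p(1-3), of k 0] periodic_reach[OF p(1-3), of 0 k] p(4) by simp_all
  have large: "l \<le> S * \<bar>l\<bar>" for l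
  proof -
    have "1 * \<bar>l\<bar> \<le> S * \<bar>l\<bar>" using p(2) by (intro mult_right_mono) auto
    then show ?thesis by linarith
  qed
  have der1: "x \<in> T derived_set_of X" if x: "x \<in> X" and xp: "\<And>k. a \<le> k \<Longrightarrow> x k = p k" for x a
    unfolding T_def in_derived_set_of_shift_iff[OF X_subset]
  proof (intro conjI allI x)
    fix m
    \<comment> \<open>A multiple of the period, so that \<open>p\<close> shows \<open>w\<close> at
      \<open>s\<close>; there \<open>x\<close> is redirected into \<open>z\<close>, which leads to
      \<open>v\<close>.\<close>
    define s where "s = S * \<bar>\<bar>a\<bar> + int m + 1\<bar>"
    have s: "a \<le> s" "int m < s" using large[of "\<bar>a\<bar> + int m + 1", folded s_def] by linarith+
    have Ws: "W x s = W (translate (- s) z) s"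
    proof -
      have "W x s = W p s" using xp s(1) by (intro W_eqI) simp
      also have "\<dots> = W p 0" using W_periodic[OF p(3), of 0] by (simp add: s_def)
      finally show ?thesis using z0 p(4) by simp
    qed
    define y where "y = splice_at s x (translate (- s) z)"
    have "y \<in> X" unfolding y_def using x z(1) Ws by (intro splice_X translate_X)
    moreover have "y \<noteq> x"
    proof
      assume "y = x"
      then have "W x (s + j) = v" using W_splice_right[of s "s + j" x "translate (- s) z"] z(2,3) by (simp add: y_def)
      moreover have "W x (s + j) = W p (s + j)" using xp s(1) z(2) by (intro W_eqI) simp
      ultimately show False using p_w(1)[of "s + j"] v(2) by simp
    qed
    moreover have "agree m x y" using s(2) by (simp add: agree_def y_def splice_at_def)
    ultimately show "\<exists>y\<in>X \<inter> X. y \<noteq> x \<and> agree m x y" by blast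
  qed
  have "p \<in> T derived_set_of (T derived_set_of X)"
    unfolding T_def in_derived_set_of_shift_iff[OF X_subset]
  proof (intro conjI allI p(1))
    fix m
    \<comment> \<open>Translation by a multiple of the period keeps the tail in phase with
      \<open>p\<close> and pushes the window \<open>u\<close> far to the left.\<close>
    define s where "s = S * \<bar>int m\<bar>"
    define x where "x = translate s y"
    have s: "int m \<le> s" using large[of "int m"] by (simp add: s_def)
    have xp: "x k = p k" if "- s \<le> k" for k
      using y(4)[of "k + s"] that periodic_mult[OF p(3), of k "\<bar>int m\<bar>"] by (simp add: x_def s_def)
    have xX: "x \<in> X" unfolding x_def using y(1) by (rule translate_X)
    have "x \<in> T derived_set_of X" using der1[OF xX xp] .
    moreover have "x \<noteq> p"
    proof
      assume "x = p"
      moreover have "W x (i - s) = u" using y(3) by (simp add: x_def)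
      ultimately show False using p_w(2)[of "i - s"] u(2) by simp
    qed
    moreover have "agree m p x" using s xp by (simp add: agree_def)
    ultimately show "\<exists>y\<in>subtopology (shift_topology A) X derived_set_of X \<inter> X. y \<noteq> p \<and> agree m p y"
      using xX unfolding T_def by blast
  qed
  then show ?thesis by blast
qed

lemma countable_rank_two_layered:
  assumes "countable X" "cb_rank (subtopology (shift_topology A) X) \<le> osucc (osucc 0)"
  shows two_layered
proof (rule ccontr)
  assume nl: "\<not> two_layered"
  let ?T = "subtopology (shift_topology A) X"
  let ?Y = "?T derived_set_of (?T derived_set_of X)"
  have top: "topspace ?T = X" by (rule topspace_subtopology_shift[OF X_subset])
  have "compact_space ?T"
    using closedin_compact_space[OF compact_shift_topology[OF finite_A] closedin_X]
    by (rule compact_space_subtopology)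
  moreover have "Hausdorff_space ?T" by (simp add: Hausdorff_shift_topology Hausdorff_space_subtopology)
  moreover note derived_fixed_if_cb_rank_le_two[OF t1_X assms(2), unfolded top]
  ultimately have "uncountable ?Y"
    using perfect_closedin_uncountable second_derived_nonempty[OF nl] by blast
  moreover have "?Y \<subseteq> X" using derived_set_of_subset_topspace[of ?T] top by metis
  ultimately show False using assms(1) countable_subset by blast
qed

subsection \<open>Three layers: a surjective endomorphism that is not injective\<close>

text \<open>Among the candidates, one that reaches the fewest windows is maximal: a strictly higher
  one would reach strictly fewer.\<close>

lemma maximal_above:
  assumes "reach v0 v0" "reach w v0" "\<not> reach v0 w"
  obtains v where "reach v v" "reach w v" "\<not> reach v w" "\<And>u. reach u u \<Longrightarrow> reach v u \<Longrightarrow> reach u v"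
proof -
  define Q where "Q v \<longleftrightarrow> reach v v \<and> reach w v \<and> \<not> reach v w" for v
  let ?up = "\<lambda>v. {u. reach v u}"
  obtain v where v: "Q v" "\<And>u. Q u \<Longrightarrow> card (?up v) \<le> card (?up u)"
    using ex_has_least_nat[of Q v0 "\<lambda>v. card (?up v)"] assms unfolding Q_def by blast
  have "reach u v" if u: "reach u u" "reach v u" for u
  proof (rule ccontr)
    assume nr: "\<not> reach u v"
    have "Q u" using v(1) u nr reach_trans unfolding Q_def by blast
    moreover have "?up u \<subset> ?up v" using u(2) v(1) nr reach_trans unfolding Q_def by blast
    moreover have "finite (?up v)" using finite_subset[OF _ finite_words, of "?up v"] reach_words by blast
    ultimately show False using v(2) psubset_card_mono by (metis leD)
  qed
  then show thesis using that v(1) unfolding Q_def by blast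
qed

text \<open>A point that is periodic through \<open>w\<close> on the left and passes through
  \<open>v\<close> is recentred at the last position from which \<open>w\<close> can be reached. Up
  to there it follows a periodic point \<open>p\<close>; \<open>m\<close> is the distance to
  \<open>v\<close>. As \<open>v\<close> is maximal, every point is periodic from an occurrence of
  \<open>v\<close> on, and \<open>T\<close> is a period common to both sides.\<close>

lemma exit_pattern:
  assumes amb: "\<not> ambiguous" and w: "reach w w" and v: "reach v v" "reach w v" "\<not> reach v w"
    and max: "\<And>u. reach u u \<Longrightarrow> reach v u \<Longrightarrow> reach u v"
  obtains x0 p T m where "x0 \<in> X" "p \<in> X" "0 < T" "periodic T p" "\<And>k. k < int n \<Longrightarrow> x0 k = p k"
    "0 < m" "\<not> reach (W x0 1) (W x0 0)" "reach (W x0 0) w" "reach w (W x0 0)"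
    "\<And>z c k. z \<in> X \<Longrightarrow> W z c = W x0 m \<Longrightarrow> c \<le> k \<Longrightarrow> z (k + T) = z k"
proof -
  obtain x i j where x: "x \<in> X" "i < j" "W x i = w" "W x j = v"
    using v(2) unfolding reach_def by blast
  obtain p' S' where p': "p' \<in> X" "0 < S'" "periodic S' p'" "W p' i = w"
    using recurrent_periodic[OF w] by metis
  have Wi: "W p' i = W x i" using p' x by simp
  define y where "y = splice_at i p' x"
  have y: "y \<in> X" "W y i = w" "W y j = v"
    using splice_X[OF p'(1) x(1) Wi] W_splice_right[of i _ p' x] x by (simp_all add: y_def)
  have yl: "W y k = W p' k" if "k \<le> i" for k using W_splice_left[OF Wi that] by (simp add: y_def)
  \<comment> \<open>The last position of the stretch from which \<open>w\<close> is still reachable;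
    leaving it means leaving the class of \<open>w\<close> for good.\<close>
  define l where "l = Max {k \<in> {i..j}. reach (W y k) w}"
  have fin: "finite {k \<in> {i..j}. reach (W y k) w}" by (rule finite_subset[of _ "{i..j}"]) auto
  have "i \<in> {k \<in> {i..j}. reach (W y k) w}" using x(2) y(2) w by simp
  then have l: "i \<le> l" "l \<le> j" "reach (W y l) w" using Max_in[OF fin] by (auto simp: l_def)
  have above: "\<not> reach (W y k) w" if "l < k" for k
  proof (cases "k \<le> j")
    case True
    have "k \<notin> {k \<in> {i..j}. reach (W y k) w}" using Max_ge[OF fin, of k] \<open>l < k\<close> by (auto simp: l_def)
    then show ?thesis using True l(1) \<open>l < k\<close> by auto
  next
    case False
    then have "reach v (W y k)" using reachI[OF y(1), of j k] y(3) by simp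
    then show ?thesis using v(3) reach_trans by blast
  qed
  have "l \<noteq> j" using l(3) y(3) v(3) by auto
  have wl: "reach w (W y l)" using reachI[OF y(1), of i l] y(2) w l(1) by (cases "i = l") auto
  have returns: "reach (W y l) (W y k)" if "k \<le> l" for k
  proof -
    have "reach w (W y k)"
    proof (cases "k \<le> i")
      case True
      then show ?thesis using yl[of k] periodic_reach[OF p'(1-3), of i k] p'(4) by simp
    next
      case False
      then show ?thesis using reachI[OF y(1), of i k] y(2) by simp
    qed
    then show ?thesis using l(3) reach_trans by blast
  qed
  define x0 where "x0 = translate l y"
  have x0: "x0 \<in> X" unfolding x0_def using y(1) by (rule translate_X)
  have W0: "W x0 k = W y (k + l)" for k by (simp add: x0_def)
  have rec0: "reach (W x0 0) (W x0 0)" using l(3) wl W0 reach_trans by (metis add_0)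
  obtain p P where p: "p \<in> X" "0 < P" "periodic P p" "W p 0 = W x0 0"
    using recurrent_periodic[OF rec0] by metis
  obtain q Q where q: "q \<in> X" "0 < Q" "periodic Q q" "W q 0 = v"
    using recurrent_periodic[OF v(1)] by metis
  obtain T where T: "0 < T" "periodic T p" "periodic T q" using periodic_common[OF p(3) q(3) p(2) q(2)] by blast
  show thesis
  proof (rule that[of x0 p T "j - l"])
    fix k assume k: "k < int n"
    show "x0 k = p k"
    proof (rule interval_eq_periodic[OF amb x0, of "min k 0" 0 p P 0])
      show "reach (W x0 0) (W x0 (min k 0))" using returns[of "min k 0 + l"] W0 by simp
    qed (use p k in auto)
  next
    show "\<not> reach (W x0 1) (W x0 0)"
      using above[of "1 + l"] W0[of 1] W0[of 0] l(3) reach_trans by auto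
  next
    fix z c k assume z: "z \<in> X" "W z c = W x0 (j - l)" "c \<le> k"
    have zv: "W z c = v" using z(2) W0[of "j - l"] y(3) by simp
    let ?q = "translate (- c) q"
    have zq: "z k' = ?q k'" if "c \<le> k'" for k'
    proof (rule interval_eq_periodic[OF amb z(1) that, of ?q Q c])
      show "reach (W z k') (W z c)" using maximal_reached_right[of z c k'] max zv z(1) that by simp
    qed (use q that zv n_pos in \<open>auto simp: translate_X periodic_translate\<close>)
    have "?q (k + T) = ?q k" using periodic_translate[OF T(3)] by (simp only: periodic_def)
    then show "z (k + T) = z k" using zq[of k] zq[of "k + T"] z(3) T(1) by simp
  qed (use x0 p T l \<open>l \<noteq> j\<close> wl W0[of 0] in auto)
qed

text \<open>Where the exit is preceded by a full period of \<open>p\<close>, the map deletes one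
  period and so slides the exit to the left. Inserting a period gives preimages, so the map is onto.
  A point whose exit is not preceded by a full period is fixed, but it is also the image of the
  point with one period inserted.\<close>

lemma not_injunctive_if_exit_pattern:
  assumes x0: "x0 \<in> X" and p: "p \<in> X" "0 < T" "periodic T p" "\<And>k. k < int n \<Longrightarrow> x0 k = p k"
    and m: "0 < m" and exit: "\<not> reach (W x0 1) (W x0 0)"
    and u: "reach u (W x0 0)" "\<not> reach (W x0 0) u"
    and tail: "\<And>z c k. z \<in> X \<Longrightarrow> W z c = W x0 m \<Longrightarrow> c \<le> k \<Longrightarrow> z (k + T) = z k"
  shows "\<not> injunctive A X"
proof -
  define occ where "occ x i \<longleftrightarrow> (\<forall>k. 0 \<le> k \<and> k < m + int n \<longrightarrow> x (i + k) = x0 k)" for x i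
  define occT where "occT x i \<longleftrightarrow> (\<forall>k. - T \<le> k \<and> k < m + int n \<longrightarrow> x (i + k) = x0 k)" for x i
  \<comment> \<open>Translating only between \<open>i - T\<close> and \<open>i + m\<close> keeps the
    rule local. From \<open>i + m\<close> on \<open>x\<close> has period \<open>T\<close>, so there
    the translation would change nothing.\<close>
  define \<tau> where "\<tau> x k = (if \<exists>i. i - T \<le> k \<and> k < i + m \<and> occT x i then x (k + T) else x k)" for x k
  have W0p: "W x0 0 = W p 0" using p(4) by (intro W_eqI) simp
  have pT: "p (k + T) = p k" for k using p(3) by (simp add: periodic_def)
  have occT_occ: "occ x i" if "occT x i" for x i using that p(2) by (auto simp: occ_def occT_def)
  have occW: "W x (i + k) = W x0 k" if "occ x i" "0 \<le> k" "k \<le> m" for x i k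
    using that by (auto simp: W_eq_iff occ_def add.assoc)
  \<comment> \<open>A second occurrence would lead from the window after the exit back to the window
    before it.\<close>
  have uniq: "i = i'" if "x \<in> X" "occ x i" "occ x i'" for x i i'
  proof -
    have False if x: "x \<in> X" "occ x i" "occ x i'" "i < i'" for i i'
    proof -
      have "W x (i + 1) = W x0 1" "W x i' = W x0 0"
        using occW[OF x(2), of 1] occW[OF x(3), of 0] m by auto
      moreover have "reach (W x0 0) (W x0 0)" using W0p periodic_reach[OF p(1-3)] by simp
      ultimately show False using exit reachI[OF x(1), of "i + 1" i'] x(4) by (cases "i' = i + 1") auto
    qed
    then show ?thesis using that by (metis linorder_neqE)
  qed
  have occT_W: "W x (i - T) = W x i" if "occT x i" for x i
    unfolding W_eq_iff
  proof (intro allI impI)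
    fix k assume k: "0 \<le> k \<and> k < int n"
    have "x (i + (k - T)) = x0 (k - T)" "x (i + k) = x0 k"
      using that k m p(2) unfolding occT_def by auto
    moreover have "x0 (k - T) = x0 k" using p(2) p(4)[of k] p(4)[of "k - T"] pT[of "k - T"] k by simp
    ultimately show "x (i - T + k) = x (i + k)" by (simp add: algebra_simps)
  qed
  have tau_id: "\<tau> x = x" if "\<And>i. \<not> occT x i" for x using that by (simp add: \<tau>_def fun_eq_iff)
  have tau_occ: "\<tau> x = splice_at (i - T) x (translate T x)" if x: "x \<in> X" "occT x i" for x i
  proof
    fix k
    have ex: "(\<exists>i'. i' - T \<le> k \<and> k < i' + m \<and> occT x i') \<longleftrightarrow> i - T \<le> k \<and> k < i + m"
      using uniq[OF x(1)] occT_occ x(2) by blast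
    have "x (k + T) = x k" if "i + m \<le> k"
      using tail[OF x(1), of "i + m" k] occW[OF occT_occ[OF x(2)], of m] m that by simp
    then show "\<tau> x k = splice_at (i - T) x (translate T x) k"
      unfolding \<tau>_def ex by (auto simp: splice_at_def)
  qed
  have tau_X: "\<tau> x \<in> X" if x: "x \<in> X" for x
  proof (cases "\<exists>i. occT x i")
    case True
    then obtain i where i: "occT x i" by blast
    have "W x (i - T) = W (translate T x) (i - T)" using occT_W[OF i] by simp
    then show ?thesis unfolding tau_occ[OF x i] using x by (intro splice_X translate_X)
  qed (use x tau_id in simp)
  have endo: "endomorphism A X \<tau>"
  proof (rule endomorphismI_local[OF X_subset tau_X, where r = "2 * T + m + int n"])
    fix x
    have occs: "occT (translate 1 x) i \<longleftrightarrow> occT x (i + 1)" for i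
      by (simp add: occT_def algebra_simps)
    show "\<tau> (shift x) = shift (\<tau> x)"
    proof
      fix k
      have "(\<exists>i. i - T \<le> k \<and> k < i + m \<and> occT x (i + 1)) \<longleftrightarrow> (\<exists>i. i - T \<le> k + 1 \<and> k + 1 < i + m \<and> occT x i)"
        (is "?l \<longleftrightarrow> ?r")
      proof
        assume ?l
        then obtain i where "i - T \<le> k \<and> k < i + m \<and> occT x (i + 1)" by blast
        then show ?r by (intro exI[of _ "i + 1"]) auto
      next
        assume ?r
        then obtain i where "i - T \<le> k + 1 \<and> k + 1 < i + m \<and> occT x i" by blast
        then show ?l by (intro exI[of _ "i - 1"]) auto
      qed
      note iff = this
      have "\<tau> (shift x) k = (if \<exists>i. i - T \<le> k \<and> k < i + m \<and> occT x (i + 1) then x (k + 1 + T) else x (k + 1))"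
        unfolding \<tau>_def shift_eq_translate occs translate_apply by (simp only: add_ac)
      then show "\<tau> (shift x) k = shift (\<tau> x) k"
        unfolding iff by (simp add: \<tau>_def shift_def)
    qed
  next
    fix x y :: "int \<Rightarrow> 'a" and k assume xy: "\<And>j. \<bar>j - k\<bar> \<le> 2 * T + m + int n \<Longrightarrow> x j = y j"
    have "occT x i \<longleftrightarrow> occT y i" if i: "i - T \<le> k" "k < i + m" for i
    proof -
      have "x (i + l) = y (i + l)" if "- T \<le> l \<and> l < m + int n" for l
        using that i p(2) by (intro xy) linarith
      then show ?thesis unfolding occT_def by auto
    qed
    then have "(\<exists>i. i - T \<le> k \<and> k < i + m \<and> occT x i) \<longleftrightarrow> (\<exists>i. i - T \<le> k \<and> k < i + m \<and> occT y i)"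
      by blast
    moreover have "x (k + T) = y (k + T)" "x k = y k" using p(2) m by (auto intro!: xy)
    ultimately show "\<tau> x k = \<tau> y k" by (simp only: \<tau>_def)
  qed
  \<comment> \<open>The preimage has one period of \<open>p\<close> inserted at \<open>i\<close>,
    which moves the exit to \<open>i + T\<close>.\<close>
  have insert: "\<exists>x\<in>X. occT x (i + T) \<and> \<tau> x = y" if y: "y \<in> X" "occ y i" for y i
  proof -
    let ?p = "translate (- i) p"
    define x1 where "x1 = splice_at i y ?p"
    define x where "x = splice_at (i + T) x1 (translate (- T) y)"
    have Wi: "W y i = W ?p i" using occW[OF y(2), of 0] m W0p by simp
    have x1: "x1 \<in> X" unfolding x1_def using y(1) p(1) Wi by (intro splice_X translate_X)
    have "W x1 (i + T) = W p T" using W_splice_right[of i "i + T" y ?p] p(2) by (simp add: x1_def)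
    also have "\<dots> = W y i" using W_periodic[OF p(3), of 0 1] Wi by simp
    finally have WT: "W x1 (i + T) = W (translate (- T) y) (i + T)" by simp
    have x: "x \<in> X" unfolding x_def using x1 y(1) WT by (intro splice_X translate_X)
    have vals: "x k = (if k < i then y k else if k < i + T then p (k - i) else y (k - T))" for k
      using p(2) by (simp add: x_def x1_def splice_at_def)
    have oT: "occT x (i + T)"
      unfolding occT_def
    proof (intro allI impI)
      fix k assume k: "- T \<le> k \<and> k < m + int n"
      show "x (i + T + k) = x0 k"
      proof (cases "k < 0")
        case True
        then show ?thesis using vals[of "i + T + k"] k p(4)[of k] pT[of k] by (simp add: add.commute)
      next
        case False
        then show ?thesis using vals[of "i + T + k"] k y(2) p(2) by (simp add: occ_def)
      qed
    qed
    have "\<tau> x = splice_at i x (translate T x)" using tau_occ[OF x oT] by simp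
    also have "\<dots> = y" using p(2) by (auto simp: splice_at_def fun_eq_iff vals)
    finally show ?thesis using x oT by blast
  qed
  have "\<tau> ` X = X"
  proof
    show "X \<subseteq> \<tau> ` X"
    proof
      fix y assume y: "y \<in> X"
      show "y \<in> \<tau> ` X"
      proof (cases "\<exists>i. occ y i")
        case True
        then show ?thesis using insert[OF y] by blast
      next
        case False
        then have "\<tau> y = y" using tau_id occT_occ by blast
        then show ?thesis using y by (metis imageI)
      qed
    qed
  qed (use tau_X in blast)
  moreover have "\<not> inj_on \<tau> X"
  proof -
    \<comment> \<open>Otherwise a full period precedes every exit. Take the window \<open>u\<close>
      as close to an exit as possible: either it lies within that period, although \<open>p\<close>
      does not reach \<open>u\<close>, or deleting the period brings it closer.\<close>
    have "\<exists>y\<in>X. occ y 0 \<and> \<not> occT y 0"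
    proof (rule ccontr)
      assume none: "\<not> ?thesis"
      define Q where "Q l \<longleftrightarrow> 0 < l \<and> (\<exists>y\<in>X. occ y 0 \<and> W y (- int l) = u)" for l :: nat
      obtain y i where y: "y \<in> X" "i < 0" "W y i = u" "\<And>k. 0 \<le> k \<Longrightarrow> y k = x0 k"
        using reach_extend_left[OF u(1) x0 refl] by metis
      have "Q (nat (- i))" unfolding Q_def using y by (auto simp: occ_def)
      then have ex: "\<exists>l. Q l" by blast
      define l where "l = (LEAST l. Q l)"
      have "Q l" unfolding l_def using ex by (rule LeastI_ex)
      then obtain z where z: "z \<in> X" "occ z 0" "W z (- int l) = u" and l: "0 < l"
        unfolding Q_def by blast
      have oT: "occT z 0" using none z by blast
      show False
      proof (cases "int l \<le> T")
        case True
        have "W z (- int l) = W p (- int l)"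
        proof (rule W_eqI)
          fix k assume k: "- int l \<le> k" "k < - int l + int n"
          then have "z (0 + k) = x0 k" using oT True m l unfolding occT_def by simp
          then show "z k = p k" using p(4)[of k] k l by simp
        qed
        then show False using z(3) u(2) W0p periodic_reach[OF p(1-3), of 0 "- int l"] by simp
      next
        case False
        define y where "y = splice_at 0 (translate (- T) z) z"
        have W0: "W (translate (- T) z) 0 = W z 0" using occT_W[OF oT] by simp
        have "y \<in> X" unfolding y_def using z(1) W0 by (intro splice_X translate_X)
        moreover have "occ y 0" using z(2) by (simp add: occ_def y_def splice_at_def)
        moreover have "W y (- int (nat (int l - T))) = u"
          using W_splice_left[OF W0, of "- int (nat (int l - T))"] z(3) False by (simp add: y_def)
        ultimately have "Q (nat (int l - T))" unfolding Q_def using False by auto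
        then have "l \<le> nat (int l - T)" unfolding l_def by (rule Least_le)
        then show False using p(2) l by linarith
      qed
    qed
    then obtain y where y: "y \<in> X" "occ y 0" "\<not> occT y 0" by blast
    have "\<not> occT y i" for i
    proof
      assume "occT y i"
      then show False using uniq[OF y(1,2) occT_occ[OF \<open>occT y i\<close>]] y(3) by simp
    qed
    then have "\<tau> y = y" by (rule tau_id)
    moreover obtain x where x: "x \<in> X" "occT x (0 + T)" "\<tau> x = y" using insert[OF y(1,2)] by blast
    moreover have "x \<noteq> y" using uniq[OF y(1,2), of "0 + T"] occT_occ[OF x(2)] p(2) by auto
    ultimately show ?thesis using y(1) unfolding inj_on_def by metis
  qed
  ultimately show ?thesis using endo unfolding injunctive_def by blast
qed

lemma injunctive_two_layered:
  assumes "\<not> ambiguous" "injunctive A X"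
  shows two_layered
proof (rule ccontr)
  assume "\<not> two_layered"
  then obtain u v0 w where w: "reach w w" and u: "reach u w" "\<not> reach w u"
    and v0: "reach v0 v0" "reach w v0" "\<not> reach v0 w"
    by (rule not_two_layeredE)
  obtain v where v: "reach v v" "reach w v" "\<not> reach v w" "\<And>u. reach u u \<Longrightarrow> reach v u \<Longrightarrow> reach u v"
    using maximal_above[OF v0] by metis
  show False
  proof (rule exit_pattern[OF assms(1) w v])
    fix x0 p T m
    assume *: "x0 \<in> X" "p \<in> X" "0 < T" "periodic T p" "\<And>k. k < int n \<Longrightarrow> x0 k = p k"
      "0 < m" "\<not> reach (W x0 1) (W x0 0)" "reach (W x0 0) w" "reach w (W x0 0)"
      "\<And>z c k. z \<in> X \<Longrightarrow> W z c = W x0 m \<Longrightarrow> c \<le> k \<Longrightarrow> z (k + T) = z k"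
    have u0: "reach u (W x0 0)" "\<not> reach (W x0 0) u" using u *(8,9) reach_trans by blast+
    have "\<not> injunctive A X"
      by (rule not_injunctive_if_exit_pattern[of x0 p T m u]) (fact * u0)+
    then show False using assms(2) by blast
  qed
qed

end

subsection \<open>Ambiguous windows: rewriting bits between markers\<close>

text \<open>Solves for bits from right to left when each is coupled to the bit \<open>N\<close>
  further right. Beyond \<open>m\<close> the bits are \<open>False\<close>, which starts the
  recursion; the guard on \<open>N\<close> ensures termination.\<close>

function solve_backwards :: "int \<Rightarrow> int \<Rightarrow> (int \<Rightarrow> bool) \<Rightarrow> (int \<Rightarrow> bool) \<Rightarrow> int \<Rightarrow> bool" where
  "solve_backwards N m M b i =
     (if N \<le> 0 \<or> m < i then False else b i \<noteq> (M (i + N) \<and> solve_backwards N m M b (i + N)))"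
  by auto
termination
  by (relation "Wellfounded.measure (\<lambda>(N, m, M, b, i). nat (m + 1 - i))") auto

declare solve_backwards.simps [simp del]

text \<open>The image of the compact space \<open>X\<close> is compact, hence closed, so density
  makes it all of \<open>X\<close>.\<close>

lemma surjective_if_dense_image:
  assumes fin: "finite A" and X: "closedin (shift_topology A) X" and e: "endomorphism A X \<tau>"
    and dense: "\<And>y m. y \<in> X \<Longrightarrow> \<exists>x\<in>X. agree m y (\<tau> x)"
  shows "\<tau> ` X = X"
proof
  let ?T = "subtopology (shift_topology A) X"
  have XA: "X \<subseteq> {x. \<forall>i. x i \<in> A}" using X by (simp add: closedin_shift_topology_iff)
  have cont: "continuous_map ?T ?T \<tau>" using e by (simp add: endomorphism_def)
  then show sub: "\<tau> ` X \<subseteq> X"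
    using continuous_map_image_subset_topspace topspace_subtopology_shift[OF XA] by metis
  have "compact_space ?T"
    using closedin_compact_space[OF compact_shift_topology[OF fin] X] by (rule compact_space_subtopology)
  then have "compactin ?T X" using topspace_subtopology_shift[OF XA] by (metis compact_space_def)
  then have "compactin ?T (\<tau> ` X)" using cont by (rule image_compactin)
  then have "compactin (shift_topology A) (\<tau> ` X)" by (simp add: compactin_subtopology)
  then have "closedin (shift_topology A) (\<tau> ` X)"
    using Hausdorff_shift_topology by (intro compactin_imp_closedin)
  then have cl: "x \<in> \<tau> ` X" if "\<forall>i. x i \<in> A" "\<forall>m. \<exists>y\<in>\<tau> ` X. agree m x y" for x
    using that unfolding closedin_shift_topology_iff by blast
  show "X \<subseteq> \<tau> ` X"
  proof
    fix y assume y: "y \<in> X"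
    show "y \<in> \<tau> ` X"
    proof (rule cl)
      show "\<forall>i. y i \<in> A" using y XA by blast
      show "\<forall>m. \<exists>z\<in>\<tau> ` X. agree m y z" using dense[OF y] by blast
    qed
  qed
qed

lemma uncountable_int_bool: "uncountable (UNIV :: (int \<Rightarrow> bool) set)"
proof
  assume "countable (UNIV :: (int \<Rightarrow> bool) set)"
  then obtain F :: "nat \<Rightarrow> int \<Rightarrow> bool" where F: "range F = UNIV"
    using range_from_nat_into[of "UNIV :: (int \<Rightarrow> bool) set"] by blast
  obtain m where "F m = (\<lambda>i. \<not> F (nat i) i)" using F by (metis UNIV_I imageE)
  then have "F m (int m) = (\<not> F (nat (int m)) (int m))" by metis
  then show False by simp
qed

section \<open>Free concatenation of two blocks and the marker\<close>

locale ambiguous_pair = window_subshift +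
  fixes p q :: "int \<Rightarrow> 'a" and T c :: int
  assumes pX: "p \<in> X" and qX: "q \<in> X" and nT: "int n \<le> T"
    and pT: "periodic T p" and qT: "periodic T q" and Wpq: "W p 0 = W q 0"
    and c: "0 \<le> c" "c < T" "p c \<noteq> q c" and c_least: "0 \<le> k \<Longrightarrow> k < c \<Longrightarrow> p k = q k"
begin

lemma T_pos: "0 < T"
  using nT n_pos by linarith

definition blocks :: "(int \<Rightarrow> bool) \<Rightarrow> int \<Rightarrow> 'a" where
  "blocks f i = (if f (i div T) then q i else p i)"

lemma div_T_eq_iff: "i div T = j \<longleftrightarrow> j * T \<le> i \<and> i < (j + 1) * T"
proof
  assume "i div T = j"
  then have "i = j * T + i mod T" using div_mult_mod_eq[of i T] by simp
  then show "j * T \<le> i \<and> i < (j + 1) * T"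
    using pos_mod_sign[OF T_pos, of i] pos_mod_bound[OF T_pos, of i] by (simp add: distrib_right)
next
  assume "j * T \<le> i \<and> i < (j + 1) * T"
  then show "i div T = j" by (intro int_div_pos_eq[of _ _ _ "i - T * j"]) (auto simp: algebra_simps)
qed

lemma pq_mult: "p (i + T * j) = p i" "q (i + T * j) = q i"
  using periodic_mult pT qT by blast+

text \<open>A window is no longer than a block, so it enters the next block by fewer than
  \<open>n\<close> letters. There \<open>p\<close> and \<open>q\<close> coincide, so the window is
  one of \<open>p\<close> or of \<open>q\<close>.\<close>

lemma blocks_X: "blocks f \<in> X"
proof (rule window_X)
  fix j
  define b where "b = j div T"
  have b: "b * T \<le> j" "j < (b + 1) * T" using div_T_eq_iff[of j b] by (simp_all add: b_def)
  have "blocks f k = (if f b then q k else p k)" if k: "j \<le> k" "k < j + int n" for k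
  proof (cases "k < (b + 1) * T")
    case True
    then have "k div T = b" using b(1) k(1) by (simp add: div_T_eq_iff)
    then show ?thesis by (simp add: blocks_def)
  next
    case False
    define l where "l = k - (b + 1) * T"
    have "0 \<le> l" "l < int n" using False k(2) b(2) by (simp_all add: l_def)
    then have "p l = q l" using W_eqD[OF Wpq, of l] by simp
    then have "p k = q k" using pq_mult[of l "b + 1"] by (simp add: l_def mult.commute)
    then show ?thesis by (simp add: blocks_def)
  qed
  then show "\<exists>y\<in>X. \<forall>k. j \<le> k \<and> k < j + int n \<longrightarrow> blocks f k = y k"
    using pX qX by (cases "f b") auto
qed

lemma inj_blocks: "inj blocks"
proof (rule injI, rule ext)
  fix f g j assume eq: "blocks f = blocks g"
  have "(c + T * j) div T = j" using c T_pos by simp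
  then show "f j = g j" using fun_cong[OF eq, of "c + T * j"] c(3)
    by (auto simp: blocks_def pq_mult split: if_splits)
qed

lemma uncountable_X: "uncountable X"
proof
  assume "countable X"
  then have "countable (range blocks)" using blocks_X by (meson countable_subset image_subsetI)
  then show False using inj_blocks uncountable_int_bool by (metis countable_image_inj_eq)
qed

text \<open>In units of \<open>T\<close>, the marker is \<open>ppppq?q\<close> followed by \<open>p\<close>; block number 5 carries the bit.\<close>

definition pat :: "bool \<Rightarrow> int \<Rightarrow> 'a" where
  "pat b = blocks (\<lambda>j. j = 4 \<or> (b \<and> j = 5) \<or> j = 6)"

lemma pat_eq:
  "pat b k = (if 4 * T \<le> k \<and> k < 5 * T \<or> (b \<and> 5 * T \<le> k \<and> k < 6 * T) \<or> 6 * T \<le> k \<and> k < 7 * T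
     then q k else p k)"
  by (simp add: pat_def blocks_def div_T_eq_iff)

text \<open>The comparison runs from offset \<open>c\<close> of block 0 to offset \<open>c\<close>
  of block 7. The last position is where the closing block shows that it is \<open>p\<close> and not
  \<open>q\<close>.\<close>

definition matches :: "bool \<Rightarrow> (int \<Rightarrow> 'a) \<Rightarrow> int \<Rightarrow> bool" where
  "matches b x i \<longleftrightarrow> (\<forall>k. c \<le> k \<and> k \<le> 7 * T + c \<longrightarrow> x (i + k) = pat b k)"

definition mark :: "(int \<Rightarrow> 'a) \<Rightarrow> int \<Rightarrow> bool" where
  "mark x i \<longleftrightarrow> matches False x i \<or> matches True x i"

text \<open>Writes the bit \<open>\<beta> i\<close> into the free block of the marker at
  \<open>i\<close> and changes nothing else. The \<open>THE\<close> is meaningful because free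
  blocks of different markers are disjoint, by \<open>mark_separated\<close>.\<close>

definition rewrite :: "(int \<Rightarrow> 'a) \<Rightarrow> (int \<Rightarrow> bool) \<Rightarrow> int \<Rightarrow> 'a" where
  "rewrite x \<beta> m = (if \<exists>i. mark x i \<and> i + 5 * T \<le> m \<and> m < i + 6 * T
     then pat (\<beta> (THE i. mark x i \<and> i + 5 * T \<le> m \<and> m < i + 6 * T))
       (m - (THE i. mark x i \<and> i + 5 * T \<le> m \<and> m < i + 6 * T))
     else x m)"

text \<open>Blocks 0 to 3 are all \<open>p\<close>; the comparison of block 3 with the
  \<open>q\<close> of block 4 stops before \<open>c\<close>, where the two first differ.\<close>

lemma pat_on:
  assumes "c \<le> k" "k < 3 * T + c"
  shows "pat b (k + T) = pat b k"
proof (cases "k < 3 * T")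
  case True
  then show ?thesis using assms T_pos c pq_mult(1)[of k 1] by (simp add: pat_eq)
next
  case False
  then have "p (k - 3 * T) = q (k - 3 * T)" using assms by (intro c_least) auto
  then have "p k = q (k + T)" using pq_mult(1)[of "k - 3 * T" 3] pq_mult(2)[of "k - 3 * T" 4] by (simp add: algebra_simps)
  then show ?thesis using False assms c T_pos by (simp add: pat_eq)
qed

lemma pat_off:
  "pat b (3 * T + c + T) \<noteq> pat b (3 * T + c)" "pat b (6 * T + c + T) \<noteq> pat b (6 * T + c)"
proof -
  have "p (3 * T + c) = p c" "q (3 * T + c + T) = q c" "q (6 * T + c) = q c" "p (6 * T + c + T) = p c"
    using pq_mult(1)[of c 3] pq_mult(2)[of c 4] pq_mult(2)[of c 6] pq_mult(1)[of c 7]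
    by (simp_all add: algebra_simps)
  then show "pat b (3 * T + c + T) \<noteq> pat b (3 * T + c)" "pat b (6 * T + c + T) \<noteq> pat b (6 * T + c)"
    using c T_pos by (simp_all add: pat_eq)
qed

text \<open>An occurrence of the marker starts with a \<open>T\<close>-periodic stretch of length \<open>3T\<close>, while
  \<open>T\<close>-periodicity fails at the offsets \<open>3T\<close> and \<open>6T\<close>: so two occurrences cannot be close.\<close>

lemma mark_separated:
  assumes "mark x i" "mark x i'" "i < i'"
  shows "i + 6 * T < i'"
proof (rule ccontr)
  assume far: "\<not> i + 6 * T < i'"
  obtain b b' where b: "matches b x i" "matches b' x i'" using assms unfolding mark_def by blast
  have on: "x (i' + k + T) = x (i' + k)" if "c \<le> k" "k < 3 * T + c" for k
    using b(2) that pat_on[OF that, of b'] T_pos unfolding matches_def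
    by (simp add: add.assoc)
  have off: "x (i + k + T) \<noteq> x (i + k)" if "k = 3 * T + c \<or> k = 6 * T + c" for k
  proof -
    have "x (i + (k + T)) = pat b (k + T)" "x (i + k) = pat b k"
      using b(1) that T_pos unfolding matches_def by auto
    then show ?thesis using pat_off that by (auto simp: add.assoc)
  qed
  show False
  \<comment> \<open>The offset \<open>3 * T + c\<close> of the first marker, or else its offset
    \<open>6 * T + c\<close>, falls into the periodic stretch of the second.\<close>
  proof (cases "i' - i \<le> 3 * T")
    case True
    have eq: "i' + (3 * T + c - (i' - i)) = i + (3 * T + c)" by simp
    show False using on[of "3 * T + c - (i' - i)", unfolded eq] off[of "3 * T + c"] assms(3) True by simp
  next
    case False
    have eq: "i' + (6 * T + c - (i' - i)) = i + (6 * T + c)" by simp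
    show False using on[of "6 * T + c - (i' - i)", unfolded eq] off[of "6 * T + c"] far False by simp
  qed
qed

lemma rewrite_core:
  assumes "mark x i" "i + 5 * T \<le> m" "m < i + 6 * T"
  shows "rewrite x \<beta> m = pat (\<beta> i) (m - i)"
proof -
  have "(THE i. mark x i \<and> i + 5 * T \<le> m \<and> m < i + 6 * T) = i"
  proof (rule the_equality)
    fix j assume j: "mark x j \<and> j + 5 * T \<le> m \<and> m < j + 6 * T"
    show "j = i"
      using mark_separated[of x i j] mark_separated[of x j i] j assms T_pos by linarith
  qed (use assms in blast)
  then show ?thesis using assms unfolding rewrite_def by auto
qed

lemma rewrite_outside:
  assumes "\<And>i. mark x i \<Longrightarrow> i + 5 * T \<le> m \<Longrightarrow> m < i + 6 * T \<Longrightarrow> False"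
  shows "rewrite x \<beta> m = x m"
  using assms unfolding rewrite_def by auto

text \<open>By the separation of markers, the free block of another marker is disjoint from the
  positions compared here.\<close>

lemma matches_rewrite:
  assumes i: "mark x i"
  shows "matches (\<beta> i) (rewrite x \<beta>) i"
  unfolding matches_def
proof (intro allI impI)
  fix k assume k: "c \<le> k \<and> k \<le> 7 * T + c"
  show "rewrite x \<beta> (i + k) = pat (\<beta> i) k"
  proof (cases "5 * T \<le> k \<and> k < 6 * T")
    case True
    then show ?thesis using rewrite_core[OF i, of "i + k"] by simp
  next
    case False
    have "rewrite x \<beta> (i + k) = x (i + k)"
    proof (rule rewrite_outside)
      fix i' assume i': "mark x i'" "i' + 5 * T \<le> i + k" "i + k < i' + 6 * T"
      then have "i' \<noteq> i" using False by auto
      then show False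
        using mark_separated[OF i i'(1)] mark_separated[OF i'(1) i] i'(2,3) k c T_pos by linarith
    qed
    moreover obtain b where "x (i + k) = pat b k" using i k unfolding mark_def matches_def by blast
    ultimately show ?thesis using False by (auto simp: pat_eq)
  qed
qed

text \<open>Old markers survive. Markers of the rewritten point are separated as well, so a new one
  would lie away from all rewritten blocks and would have been a marker before.\<close>

lemma mark_rewrite [simp]: "mark (rewrite x \<beta>) i \<longleftrightarrow> mark x i"
proof
  show m: "mark x i \<Longrightarrow> mark (rewrite x \<beta>) i" for i
    using matches_rewrite[of x i \<beta>] unfolding mark_def by (cases "\<beta> i") auto
  assume i: "mark (rewrite x \<beta>) i"
  show "mark x i"
  proof (rule ccontr)
    assume nm: "\<not> mark x i"
    have "rewrite x \<beta> (i + k) = x (i + k)" if k: "c \<le> k \<and> k \<le> 7 * T + c" for k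
    proof (rule rewrite_outside)
      fix i' assume i': "mark x i'" "i' + 5 * T \<le> i + k" "i + k < i' + 6 * T"
      then have "i' \<noteq> i" using nm by auto
      then show False
        using mark_separated[OF i m[OF i'(1)]] mark_separated[OF m[OF i'(1)] i] i'(2,3) k c T_pos by linarith
    qed
    then show False using i nm unfolding mark_def matches_def by auto
  qed
qed

lemma not_both_match: "matches True x i \<Longrightarrow> \<not> matches False x i"
proof
  assume *: "matches True x i" "matches False x i"
  have "c \<le> 5 * T + c \<and> 5 * T + c \<le> 7 * T + c" using T_pos by simp
  then have "x (i + (5 * T + c)) = pat True (5 * T + c)" "x (i + (5 * T + c)) = pat False (5 * T + c)"
    using * unfolding matches_def by blast+
  then show False using pq_mult[of c 5] c T_pos by (simp add: pat_eq algebra_simps)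
qed

lemma bit_rewrite [simp]: "mark x i \<Longrightarrow> matches True (rewrite x \<beta>) i \<longleftrightarrow> \<beta> i"
  using matches_rewrite[of x i \<beta>] not_both_match by (cases "\<beta> i") auto

lemma rewrite_cong:
  assumes "\<And>i. mark x i \<Longrightarrow> i + 5 * T \<le> m \<Longrightarrow> m < i + 6 * T \<Longrightarrow> \<beta> i = \<beta>' i"
  shows "rewrite x \<beta> m = rewrite x \<beta>' m"
proof (cases "\<exists>i. mark x i \<and> i + 5 * T \<le> m \<and> m < i + 6 * T")
  case True
  then obtain i where i: "mark x i" "i + 5 * T \<le> m" "m < i + 6 * T" by blast
  show ?thesis unfolding rewrite_core[OF i] assms[OF i] ..
next
  case False
  then show ?thesis unfolding rewrite_def by auto
qed

lemma rewrite_rewrite [simp]: "rewrite (rewrite x \<beta>) \<beta>' = rewrite x \<beta>'"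
proof
  fix m
  show "rewrite (rewrite x \<beta>) \<beta>' m = rewrite x \<beta>' m"
  proof (cases "\<exists>i. mark x i \<and> i + 5 * T \<le> m \<and> m < i + 6 * T")
    case True
    then obtain i where i: "mark x i" "i + 5 * T \<le> m" "m < i + 6 * T" by blast
    then show ?thesis using rewrite_core[of "rewrite x \<beta>" i m \<beta>'] rewrite_core[OF i] by simp
  next
    case False
    then show ?thesis unfolding rewrite_def[of "rewrite x \<beta>"] by (auto simp: rewrite_def)
  qed
qed

lemma rewrite_bits [simp]: "rewrite x (matches True x) = x"
proof
  fix m
  show "rewrite x (matches True x) m = x m"
  proof (cases "\<exists>i. mark x i \<and> i + 5 * T \<le> m \<and> m < i + 6 * T")
    case True
    then obtain i where i: "mark x i" "i + 5 * T \<le> m" "m < i + 6 * T" by blast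
    have "matches (matches True x i) x i" using i(1) unfolding mark_def by (cases "matches True x i") auto
    moreover have "c \<le> m - i \<and> m - i \<le> 7 * T + c" using i c T_pos by linarith
    ultimately have "x (i + (m - i)) = pat (matches True x i) (m - i)" unfolding matches_def by blast
    then show ?thesis using rewrite_core[OF i] by simp
  qed (use rewrite_outside in blast)
qed

text \<open>A window that meets a rewritten block lies within the surrounding marker, by
  \<open>n \<le> T\<close>, and so occurs in a point made of blocks; any other window is
  unchanged.\<close>

lemma rewrite_X:
  assumes x: "x \<in> X"
  shows "rewrite x \<beta> \<in> X"
proof (rule window_X)
  fix j
  show "\<exists>y\<in>X. \<forall>k. j \<le> k \<and> k < j + int n \<longrightarrow> rewrite x \<beta> k = y k"
  proof (cases "\<exists>i k. mark x i \<and> i + 5 * T \<le> k \<and> k < i + 6 * T \<and> j \<le> k \<and> k < j + int n")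
    case True
    then obtain i k where i: "mark x i" "i + 5 * T \<le> k" "k < i + 6 * T" "j \<le> k" "k < j + int n" by blast
    have "rewrite x \<beta> l = translate (- i) (pat (\<beta> i)) l" if "j \<le> l \<and> l < j + int n" for l
    proof -
      have "c \<le> l - i \<and> l - i \<le> 7 * T + c" using i that nT c by linarith
      then have "rewrite x \<beta> (i + (l - i)) = pat (\<beta> i) (l - i)"
        using matches_rewrite[OF i(1), of \<beta>] unfolding matches_def by blast
      then show ?thesis by simp
    qed
    moreover have "translate (- i) (pat (\<beta> i)) \<in> X" unfolding pat_def using blocks_X by (rule translate_X)
    ultimately show ?thesis by blast
  next
    case False
    then have "rewrite x \<beta> k = x k" if "j \<le> k \<and> k < j + int n" for k
      using that by (intro rewrite_outside) blast
    then show ?thesis using x by blast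
  qed
qed

text \<open>Adjacent markers are \<open>7 * T\<close> apart: the closing \<open>p\<close> of one is
  the opening \<open>p\<close> of the next.\<close>

definition xor_next :: "(int \<Rightarrow> 'a) \<Rightarrow> int \<Rightarrow> 'a" where
  "xor_next x = rewrite x (\<lambda>i. matches True x i \<noteq> (mark x (i + 7 * T) \<and> matches True x (i + 7 * T)))"

lemma matches_translate: "matches b (translate l x) i \<longleftrightarrow> matches b x (i + l)"
  by (simp add: matches_def add_ac)

lemma mark_translate: "mark (translate l x) i \<longleftrightarrow> mark x (i + l)"
  by (simp add: mark_def matches_translate)

lemma rewrite_translate: "rewrite (translate l x) (\<lambda>i. \<beta> (i + l)) = translate l (rewrite x \<beta>)"
proof
  fix m
  show "rewrite (translate l x) (\<lambda>i. \<beta> (i + l)) m = translate l (rewrite x \<beta>) m"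
  proof (cases "\<exists>i. mark (translate l x) i \<and> i + 5 * T \<le> m \<and> m < i + 6 * T")
    case True
    then obtain i where i: "mark (translate l x) i" "i + 5 * T \<le> m" "m < i + 6 * T" by blast
    have "rewrite x \<beta> (m + l) = pat (\<beta> (i + l)) (m + l - (i + l))"
      using i by (intro rewrite_core) (auto simp: mark_translate)
    then show ?thesis using rewrite_core[OF i, of "\<lambda>i. \<beta> (i + l)"] by simp
  next
    case False
    then have "rewrite (translate l x) (\<lambda>i. \<beta> (i + l)) m = translate l x m"
      by (intro rewrite_outside) blast
    moreover have "rewrite x \<beta> (m + l) = x (m + l)"
    proof (rule rewrite_outside)
      fix i assume "mark x i" "i + 5 * T \<le> m + l" "m + l < i + 6 * T"
      then have "mark (translate l x) (i - l) \<and> i - l + 5 * T \<le> m \<and> m < i - l + 6 * T"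
        by (simp add: mark_translate)
      then show False using False by blast
    qed
    ultimately show ?thesis by simp
  qed
qed

lemma endomorphism_xor_next: "endomorphism A X xor_next"
\<comment> \<open>The markers consulted at \<open>k\<close> start between \<open>k - 6 * T\<close>
  and \<open>k + 2 * T\<close> and extend less than \<open>8 * T\<close> to the right, so
  \<open>20 * T\<close> is ample.\<close>
proof (rule endomorphismI_local[OF X_subset, where r = "20 * T"])
  fix x :: "int \<Rightarrow> 'a" assume x: "x \<in> X"
  then show "xor_next x \<in> X" unfolding xor_next_def by (rule rewrite_X)
  let ?\<beta> = "\<lambda>i. matches True x i \<noteq> (mark x (i + 7 * T) \<and> matches True x (i + 7 * T))"
  have "xor_next (translate 1 x) = rewrite (translate 1 x) (\<lambda>i. ?\<beta> (i + 1))"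
    unfolding xor_next_def mark_translate matches_translate by (simp only: add_ac)
  then show "xor_next (shift x) = shift (xor_next x)"
    unfolding shift_eq_translate rewrite_translate[of 1 x ?\<beta>] by (simp only: xor_next_def)
next
  fix x y :: "int \<Rightarrow> 'a" and k
  assume xy: "\<And>j. \<bar>j - k\<bar> \<le> 20 * T \<Longrightarrow> x j = y j"
  have m: "matches b x i \<longleftrightarrow> matches b y i" if "k - 6 * T \<le> i" "i \<le> k + 7 * T" for b i
  proof -
    have "x (i + l) = y (i + l)" if "c \<le> l \<and> l \<le> 7 * T + c" for l
      using that \<open>k - 6 * T \<le> i\<close> \<open>i \<le> k + 7 * T\<close> c by (intro xy) linarith
    then show ?thesis unfolding matches_def by auto
  qed
  have eq: "mark x i \<longleftrightarrow> mark y i" "matches True x i \<longleftrightarrow> matches True y i"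
    "mark x (i + 7 * T) \<longleftrightarrow> mark y (i + 7 * T)" "matches True x (i + 7 * T) \<longleftrightarrow> matches True y (i + 7 * T)"
    if "i + 5 * T \<le> k" "k < i + 6 * T" for i
    using m[of i] m[of "i + 7 * T"] that T_pos by (auto simp: mark_def)
  show "xor_next x k = xor_next y k"
  proof (cases "\<exists>i. mark x i \<and> i + 5 * T \<le> k \<and> k < i + 6 * T")
    case True
    then obtain i where i: "mark x i" "i + 5 * T \<le> k" "k < i + 6 * T" by blast
    have iy: "mark y i" using i eq(1)[of i] by simp
    show ?thesis
      unfolding xor_next_def rewrite_core[OF i] rewrite_core[OF iy i(2,3)] eq(2-4)[OF i(2,3)] ..
  next
    case False
    then have "xor_next x k = x k" "xor_next y k = y k"
      unfolding xor_next_def using eq(1) by (intro rewrite_outside; blast)+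
    moreover have "x k = y k" using T_pos by (intro xy) simp
    ultimately show ?thesis by simp
  qed
qed

text \<open>Up to any position \<open>m\<close> the bits of a preimage can be solved for from right
  to left, since each depends only on the next one. This gives dense image, and compactness does the
  rest.\<close>

lemma xor_next_surj: "xor_next ` X = X"
proof (rule surjective_if_dense_image[OF finite_A closedin_X endomorphism_xor_next])
  fix y m assume y: "y \<in> X"
  define \<beta> where "\<beta> = solve_backwards (7 * T) (int m) (mark y) (matches True y)"
  have \<beta>: "\<beta> i = (matches True y i \<noteq> (mark y (i + 7 * T) \<and> \<beta> (i + 7 * T)))" if "i \<le> int m" for i
    using that T_pos solve_backwards.simps[of "7 * T" "int m" "mark y" "matches True y" i]
    by (simp add: \<beta>_def)
  define x where "x = rewrite y \<beta>"
  have "xor_next x k = y k" if k: "k \<le> int m" for k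
  proof -
    have "xor_next x k = rewrite x (matches True y) k"
      unfolding xor_next_def
    proof (rule rewrite_cong)
      fix i assume i: "mark x i" "i + 5 * T \<le> k" "k < i + 6 * T"
      then have "mark y i" by (simp add: x_def)
      then show "(matches True x i \<noteq> (mark x (i + 7 * T) \<and> matches True x (i + 7 * T))) = matches True y i"
        using \<beta>[of i] i(2) k T_pos by (auto simp: x_def)
    qed
    then show ?thesis by (simp add: x_def)
  qed
  then have "agree m y (xor_next x)" by (simp add: agree_def)
  then show "\<exists>x\<in>X. agree m y (xor_next x)" using rewrite_X[OF y] unfolding x_def by blast
qed

text \<open>In a point of period \<open>7 * T\<close> every marker has an adjacent one to its right
  with the same bit, so all bits become \<open>False\<close>. The chain of adjacent markers
  \<open>y\<close> and its version with all bits \<open>True\<close> therefore have the same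
  image.\<close>

lemma xor_next_not_inj: "\<not> inj_on xor_next X"
proof -
  define y where "y = blocks (\<lambda>j. j mod 7 = 4 \<or> j mod 7 = 6)"
  have y: "y \<in> X" unfolding y_def by (rule blocks_X)
  have "translate (7 * T) y = y"
  proof
    fix i
    have "(i + 7 * T) div T = i div T + 7" using T_pos by simp
    then have "(i + 7 * T) div T mod 7 = i div T mod 7" by simp
    then show "translate (7 * T) y i = y i"
      using pq_mult[of i 7] by (simp add: y_def blocks_def mult.commute)
  qed
  then have per: "mark y (i + 7 * T) = mark y i" "matches b y (i + 7 * T) = matches b y i" for i b
    using mark_translate[of "7 * T" y i] matches_translate[of b "7 * T" y i] by simp_all
  have m0: "matches False y 0"
    unfolding matches_def
  proof (intro allI impI)
    fix k assume k: "c \<le> k \<and> k \<le> 7 * T + c"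
    define j where "j = k div T"
    have "j * T \<le> k" "k < (j + 1) * T" using div_T_eq_iff[of k j] by (simp_all add: j_def)
    moreover have "0 \<le> j" using k c T_pos by (simp add: j_def pos_imp_zdiv_nonneg_iff)
    moreover have "j < 8"
    proof (rule ccontr)
      assume "\<not> j < 8"
      then have "8 * T \<le> j * T" using T_pos by (intro mult_right_mono) auto
      then show False using \<open>j * T \<le> k\<close> k c by linarith
    qed
    ultimately have "j \<in> {0..7}" by simp
    then have "j \<in> {0, 1, 2, 3, 4, 5, 6, 7}" by auto
    then have "(j mod 7 = 4 \<or> j mod 7 = 6) = (j = 4 \<or> j = 6)" by auto
    then show "y (0 + k) = pat False k" by (simp add: y_def pat_def blocks_def j_def)
  qed
  define x where "x = rewrite y (\<lambda>_. True)"
  have "xor_next x = rewrite x (\<lambda>_. False)"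
    unfolding xor_next_def by (rule ext, rule rewrite_cong) (simp add: x_def per)
  moreover have "xor_next y = rewrite y (\<lambda>_. False)"
    unfolding xor_next_def by (rule ext, rule rewrite_cong) (simp add: per)
  ultimately have "xor_next x = xor_next y" by (simp add: x_def)
  moreover have "x \<in> X" unfolding x_def using y by (rule rewrite_X)
  moreover have "x \<noteq> y"
  proof
    assume "x = y"
    moreover have "mark y 0" using m0 by (simp add: mark_def)
    ultimately have "matches True y 0" using bit_rewrite[of y 0 "\<lambda>_. True"] by (simp add: x_def)
    then show False using m0 not_both_match by blast
  qed
  ultimately show ?thesis using y unfolding inj_on_def by blast
qed

lemma not_injunctive: "\<not> injunctive A X"
  unfolding injunctive_def using endomorphism_xor_next xor_next_surj xor_next_not_inj by blast

end

section \<open>From ambiguity and finite type to the two locales\<close>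

context window_subshift
begin

lemma ambiguous_pairE:
  assumes ambiguous
  obtains p q T c where "ambiguous_pair A X n p q T c"
proof -
  obtain p q S where pq: "p \<in> X" "q \<in> X" "0 < S" "periodic S p" "periodic S q" "p \<noteq> q" "W p 0 = W q 0"
    using assms unfolding ambiguous_def by blast
  \<comment> \<open>A multiple of the common period that is at least the window length, so that a
    window meets at most two blocks.\<close>
  define T where "T = S * int n"
  have T: "int n \<le> T" "0 < T" using pq(3) n_pos by (simp_all add: T_def)
  have per: "periodic T p" "periodic T q" using periodic_times pq(4,5) by (simp_all add: T_def)
  obtain k where "p k \<noteq> q k" using pq(6) by blast
  then have ne: "p (int (nat (k mod T))) \<noteq> q (int (nat (k mod T)))"
    using periodic_mod[OF per(1), of k] periodic_mod[OF per(2), of k] T(2) by simp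
  define d where "d = (LEAST d. p (int d) \<noteq> q (int d))"
  have d: "p (int d) \<noteq> q (int d)" unfolding d_def by (rule LeastI) (rule ne)
  have "d \<le> nat (k mod T)" unfolding d_def using ne by (rule Least_le)
  then have "int d < T" using pos_mod_bound[OF T(2), of k] pos_mod_sign[OF T(2), of k] by linarith
  moreover have "p l = q l" if "0 \<le> l" "l < int d" for l
    using not_less_Least[of "nat l" "\<lambda>d. p (int d) \<noteq> q (int d)"] that unfolding d_def[symmetric] by auto
  ultimately have "ambiguous_pair A X n p q T (int d)"
    using pq T per d by unfold_locales auto
  then show thesis by (rule that)
qed

end

text \<open>\<open>window n x i\<close> occupies the positions \<open>i + 1\<close> to
  \<open>i + n\<close>; length \<open>n + 1\<close> also covers \<open>i\<close> and is positive
  even when \<open>n = 0\<close>.\<close>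

lemma window_subshift_if_finite_type:
  assumes "finite A" "subshift_of_finite_type A X"
  obtains n where "window_subshift A X n"
proof -
  obtain n S where X: "X = {x. (\<forall>i. x i \<in> A) \<and> (\<forall>i. window n x i \<in> S)}"
    using assms(2) unfolding subshift_of_finite_type_def by blast
  have "window_subshift A X (n + 1)"
  proof
    fix x :: "int \<Rightarrow> 'a" and k assume x: "x \<in> X"
    have "window n (translate k x) i = window n x (i + k)" for i
      by (simp add: window_def add_ac)
    then show "translate k x \<in> X" using x by (simp add: X)
  next
    fix x :: "int \<Rightarrow> 'a"
    assume loc: "\<And>i. \<exists>y\<in>X. \<forall>k. i \<le> k \<and> k < i + int (n + 1) \<longrightarrow> x k = y k"
    have "x i \<in> A" for i
    proof -
      obtain y where "y \<in> X" "x i = y i" using loc[of i] by auto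
      then show ?thesis by (simp add: X)
    qed
    moreover have "window n x i \<in> S" for i
    proof -
      obtain y where y: "y \<in> X" "\<forall>k. i \<le> k \<and> k < i + int (n + 1) \<longrightarrow> x k = y k" using loc by blast
      then have "window n x i = window n y i" by (auto simp: window_def)
      then show ?thesis using y(1) by (simp add: X)
    qed
    ultimately show "x \<in> X" by (simp add: X)
  qed (use assms(1) X in auto)
  then show thesis by (rule that)
qed

theorem theorem1p3:
  fixes A :: "'a set" and X :: "(int \<Rightarrow> 'a) set"
  assumes "finite A" and "subshift_of_finite_type A X"
  shows "(injunctive A X \<longleftrightarrow>
            (\<forall>C\<in>irreducible_components A X.
               finite C \<and> extremal_in (irreducible_components A X) (component_le A X) C)) \<and>
         ((\<forall>C\<in>irreducible_components A X.
               finite C \<and> extremal_in (irreducible_components A X) (component_le A X) C) \<longleftrightarrow>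
            countable X \<and> cb_rank (subtopology (shift_topology A) X) \<le> osucc (osucc 0))"
proof -
  obtain n where "window_subshift A X n" using window_subshift_if_finite_type[OF assms] .
  then interpret window_subshift A X n .
  have amb: "\<not> injunctive A X" "uncountable X" if a: ambiguous
  proof -
    obtain p q T c where "ambiguous_pair A X n p q T c" using ambiguous_pairE[OF a] .
    then interpret ambiguous_pair A X n p q T c .
    show "\<not> injunctive A X" "uncountable X" using not_injunctive uncountable_X by auto
  qed
  show ?thesis
    unfolding finite_extremal_iff
    using amb two_layered_injunctive injunctive_two_layered two_layered_countable
      two_layered_cb_rank countable_rank_two_layered by blast
qed

end
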